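(* Let $(R,\mathfrak m,k)$ be a noetherian commutative complete local ring of prime characteristic $p$. Assume that the residue field $k$ is separably closed and that $\operatorname{depth}(R)\geq 3$. Then $\widetilde{H}_0(\Delta(R);k)=\widetilde{H}_1(\Delta(R);k)=0$.
   Context: For a noetherian commutative local ring $R$ with maximal ideal $\mathfrak m$ and minimal primes $\mathfrak p_1,\dots,\mathfrak p_n$, $\Delta(R)$ is the simplicial complex on the vertex set $\{1,\dots,n\}$ in which a subset $\{i_0,\dots,i_s\}$ is a face if and only if $\sqrt{\mathfrak p_{i_0}+\cdots+\mathfrak p_{i_s}}\neq\mathfrak m$. $\widetilde{H}_j(\Delta(R);k)$ denotes the $j$-th reduced (simplicial/singular) homology of $\Delta(R)$ with coefficients in $k$. *)

theory Defs
  imports "HOL-Algebra.Algebra"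
begin

definition rad :: "('a, 'b) ring_scheme \<Rightarrow> 'a set \<Rightarrow> 'a set" where
  "rad R I = {x \<in> carrier R. \<exists>n::nat. x [^]\<^bsub>R\<^esub> n \<in> I}"

definition minimal_prime :: "('a, 'b) ring_scheme \<Rightarrow> 'a set \<Rightarrow> bool" where
  "minimal_prime R P \<longleftrightarrow> primeideal P R \<and> (\<forall>Q. primeideal Q R \<and> Q \<subseteq> P \<longrightarrow> Q = P)"

definition local_ring :: "('a, 'b) ring_scheme \<Rightarrow> 'a set \<Rightarrow> bool" where
  "local_ring R m \<longleftrightarrow> cring R \<and> maximalideal m R \<and> (\<forall>I. maximalideal I R \<longrightarrow> I = m)"

primrec ideal_pow :: "('a, 'b) ring_scheme \<Rightarrow> 'a set \<Rightarrow> nat \<Rightarrow> 'a set" where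
  "ideal_pow R I 0 = carrier R"
| "ideal_pow R I (Suc n) = ideal_prod R I (ideal_pow R I n)"

definition adic_complete :: "('a, 'b) ring_scheme \<Rightarrow> 'a set \<Rightarrow> bool" where
  "adic_complete R I \<longleftrightarrow>
     (\<forall>x. (\<forall>n. x n \<in> carrier R) \<and> (\<forall>n. x (Suc n) \<ominus>\<^bsub>R\<^esub> x n \<in> ideal_pow R I n)
        \<longrightarrow> (\<exists>y \<in> carrier R. \<forall>n. y \<ominus>\<^bsub>R\<^esub> x n \<in> ideal_pow R I n))"

definition has_char :: "('a, 'b) ring_scheme \<Rightarrow> nat \<Rightarrow> bool" where
  "has_char R p \<longleftrightarrow> p > 0 \<and> add_pow R p \<one>\<^bsub>R\<^esub> = \<zero>\<^bsub>R\<^esub> \<and>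
     (\<forall>q. 0 < q \<and> q < p \<longrightarrow> add_pow R q \<one>\<^bsub>R\<^esub> \<noteq> \<zero>\<^bsub>R\<^esub>)"

definition regular_sequence :: "('a, 'b) ring_scheme \<Rightarrow> 'a list \<Rightarrow> bool" where
  "regular_sequence R xs \<longleftrightarrow> set xs \<subseteq> carrier R \<and>
     genideal R (set xs) \<noteq> carrier R \<and>
     (\<forall>i < length xs. \<forall>y \<in> carrier R.
        (xs ! i) \<otimes>\<^bsub>R\<^esub> y \<in> genideal R (set (take i xs)) \<longrightarrow> y \<in> genideal R (set (take i xs)))"

definition depth_ge :: "('a, 'b) ring_scheme \<Rightarrow> 'a set \<Rightarrow> nat \<Rightarrow> bool" where
  "depth_ge R m d \<longleftrightarrow> (\<exists>xs. length xs = d \<and> set xs \<subseteq> m \<and> regular_sequence R xs)"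

text \<open>Formal derivative of a polynomial (HOL-Algebra list representation, leading coefficient first).\<close>
definition poly_deriv :: "('a, 'b) ring_scheme \<Rightarrow> 'a list \<Rightarrow> 'a list" where
  "poly_deriv K p = ring.normalize K
     (map (\<lambda>j. add_pow K (length p - 1 - j) (p ! j)) [0..<length p - 1])"

definition separable_poly :: "('a, 'b) ring_scheme \<Rightarrow> 'a list \<Rightarrow> bool" where
  "separable_poly K f \<longleftrightarrow>
     (\<exists>a b. polynomial\<^bsub>K\<^esub> (carrier K) a \<and> polynomial\<^bsub>K\<^esub> (carrier K) b \<and>
        ring.poly_add K (ring.poly_mult K a f) (ring.poly_mult K b (poly_deriv K f)) = [\<one>\<^bsub>K\<^esub>])"

definition separably_closed :: "('a, 'b) ring_scheme \<Rightarrow> bool" where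
  "separably_closed K \<longleftrightarrow> field K \<and>
     (\<forall>f. polynomial\<^bsub>K\<^esub> (carrier K) f \<and> length f \<ge> 2 \<and> separable_poly K f
        \<longrightarrow> (\<exists>x \<in> carrier K. ring.eval K f x = \<zero>\<^bsub>K\<^esub>))"

text \<open>Given an enumeration P of the minimal primes by {1..n}, the faces of Delta(R).\<close>
definition Delta :: "('a, 'b) ring_scheme \<Rightarrow> 'a set \<Rightarrow> nat \<Rightarrow> (nat \<Rightarrow> 'a set) \<Rightarrow> nat set set" where
  "Delta R m n P = {F. F \<subseteq> {1..n} \<and> F \<noteq> {} \<and> rad R (genideal R (\<Union>i\<in>F. P i)) \<noteq> m}"

text \<open>Faces of the augmented complex (empty face added) with d vertices (dimension d-1).\<close>
definition faces :: "nat set set \<Rightarrow> nat \<Rightarrow> nat set set" where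
  "faces D d = {F \<in> insert {} D. card F = d}"

text \<open>Simplicial d-vertex chains with coefficients in K (functions on oriented faces,
  orientation given by the natural order of vertices), zero outside the faces.\<close>
definition chains :: "('c, 'e) ring_scheme \<Rightarrow> nat set set \<Rightarrow> nat \<Rightarrow> (nat set \<Rightarrow> 'c) set" where
  "chains K D d = {c. (\<forall>F \<in> faces D d. c F \<in> carrier K) \<and> (\<forall>F. F \<notin> faces D d \<longrightarrow> c F = \<zero>\<^bsub>K\<^esub>)}"

text \<open>Boundary map from (Suc d)-vertex chains to d-vertex chains:
  the face of sigma obtained by deleting its vertex v gets sign (-1)^(number of vertices of sigma below v).\<close>
definition bdry :: "('c, 'e) ring_scheme \<Rightarrow> nat set set \<Rightarrow> nat \<Rightarrow> (nat set \<Rightarrow> 'c) \<Rightarrow> (nat set \<Rightarrow> 'c)" where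
  "bdry K D d c = (\<lambda>\<tau>. if \<tau> \<in> faces D d then
      finsum K (\<lambda>\<sigma>. if even (card {u \<in> \<sigma>. u < the_elem (\<sigma> - \<tau>)}) then c \<sigma> else \<ominus>\<^bsub>K\<^esub> c \<sigma>)
        {\<sigma> \<in> faces D (Suc d). \<tau> \<subseteq> \<sigma>}
    else \<zero>\<^bsub>K\<^esub>)"

definition reduced_homology_zero :: "('c, 'e) ring_scheme \<Rightarrow> nat set set \<Rightarrow> nat \<Rightarrow> bool" where
  "reduced_homology_zero K D j \<longleftrightarrow>
     (\<forall>c \<in> chains K D (Suc j). bdry K D j c = (\<lambda>_. \<zero>\<^bsub>K\<^esub>) \<longrightarrow>
        (\<exists>e \<in> chains K D (Suc (Suc j)). bdry K D (Suc j) e = c))"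

end

theory Submission
  imports Defs "HOL-Decision_Procs.Algebra_Aux" "HOL-Number_Theory.Residues"
begin

text \<open>Let \<open>U\<close> be the punctured spectrum. Since \<open>U\<close> is covered by open sets on which only the
  components of one face of the complex meet, a cocycle of the complex modulo \<open>p\<close> defines a Cech
  cocycle of the constant sheaf \<open>\<int>/p\<close> on \<open>U\<close>. Depth at least \<open>3\<close> gives \<open>H\<^sup>0(U, O) = R\<close> and
  \<open>H\<^sup>1(U, O) = 0\<close>, so the cocycle is a coboundary \<open>g\<^sub>i - g\<^sub>j\<close> of sections of the structure sheaf;
  the sections \<open>g\<^sub>i\<^sup>p - g\<^sub>i\<close> glue to an element of \<open>R\<close>, which has the form \<open>r\<^sup>p - r\<close> because \<open>R\<close> is
  complete with separably closed residue field. The sections \<open>g\<^sub>i - r\<close> satisfy \<open>x\<^sup>p = x\<close>, hence are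
  locally constant in the prime field and trivialise the cocycle. Localisations are avoided by writing
  \<open>g\<^sub>i = a\<^sub>i / f\<^sub>i\<close> and clearing denominators: the two vanishing statements become the vanishing
  of Koszul cohomology in degrees \<open>1\<close> and \<open>2\<close>. Homology with coefficients in the residue field
  vanishes by linear duality over the prime field.\<close>

section \<open>Vanishing of Koszul cohomology below the depth\<close>

text \<open>Cochains are integer-valued functions considered modulo p, so that one and the same
  value can be read in R, in R modulo a prime and in the residue field. The boundary matrix has
  integer entries, and this is why vanishing over the prime field suffices for homology over k. The
  obstacle is that the charts form a possibly infinite family whose members may be zero divisors. No
  finite subcover is extracted and nothing is inverted. Instead, for each system of equations, the
  multipliers s for which s times the given data is solvable form an ideal. It contains the
  denominators by the cocycle identity, hence a power of each element of m, and an element of the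
  regular sequence is cancelled from such a power until 1 is reached. Justifying the cancellation in
  one Koszul degree uses the degree below modulo one more element of the sequence; this is how
  degree two consumes exactly three elements.\<close>

lemma (in cring) one_mem_of_power_mem:
  assumes "y \<in> carrier R" "A \<subseteq> carrier R"
    and cancel: "\<And>s. s \<in> carrier R \<Longrightarrow> y \<otimes> s \<in> A \<Longrightarrow> s \<in> A"
    and "y [^] (N::nat) \<in> A"
  shows "\<one> \<in> A"
  using assms(4)
proof (induction N)
  case (Suc N)
  then show ?case using assms(1) cancel[of "y [^] N"] by (simp add: m_comm)
qed (simp)

lemma (in cring) cring_idealI:
  assumes "A \<subseteq> carrier R" "\<zero> \<in> A"
    and "\<And>a b. a \<in> A \<Longrightarrow> b \<in> A \<Longrightarrow> a \<oplus> b \<in> A"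
    and mult: "\<And>a x. a \<in> A \<Longrightarrow> x \<in> carrier R \<Longrightarrow> x \<otimes> a \<in> A"
  shows "ideal A R"
proof (rule idealI[OF ring_axioms])
  have "\<ominus> a \<in> A" if "a \<in> A" for a
    using mult[OF that, of "\<ominus> \<one>"] assms(1) that by (auto simp: l_minus)
  then show "subgroup A (add_monoid R)"
    using assms by (intro add.subgroupI) auto
  show "\<And>a x. a \<in> A \<Longrightarrow> x \<in> carrier R \<Longrightarrow> a \<otimes> x \<in> A"
    using mult assms(1) by (metis m_comm subsetD)
qed (use mult in auto)

text \<open>The multipliers \<open>s\<close> with \<open>s \<otimes> u \<in> I\<close> form an ideal
  containing \<open>T\<close>, hence a power of \<open>z\<close>; since \<open>z\<close> cancels
  modulo \<open>I\<close>, they include \<open>\<one>\<close>. This is the bottom of the descent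
  through the Koszul degrees.\<close>

lemma (in cring) koszul_vanishing0:
  assumes I: "ideal I R" and T: "T \<subseteq> carrier R"
    and z: "z \<in> carrier R" "\<And>v. v \<in> carrier R \<Longrightarrow> z \<otimes> v \<in> I \<Longrightarrow> v \<in> I"
    and zN: "z [^] (N::nat) \<in> Idl T"
    and u: "u \<in> carrier R" "\<And>f. f \<in> T \<Longrightarrow> f \<otimes> u \<in> I"
  shows "u \<in> I"
proof -
  interpret I: ideal I R by (rule I)
  define A where "A = {s \<in> carrier R. s \<otimes> u \<in> I}"
  have "ideal A R"
    unfolding A_def using u(1) by (intro cring_idealI) (auto simp: l_distr m_assoc I.I_l_closed)
  then have "Idl T \<subseteq> A"
    using T u(2) by (intro genideal_minimal) (auto simp: A_def)
  then have "\<one> \<in> A"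
    using z(1) zN u(1) by (intro one_mem_of_power_mem[of z A N]) (auto simp: A_def m_assoc intro: z(2))
  then show ?thesis
    using u(1) by (simp add: A_def)
qed

text \<open>The multiplier \<open>\<phi> g\<close> is admissible with witness \<open>a g\<close>, by
  the cocycle condition. Cancelling \<open>y\<close> requires the witness of
  \<open>y \<otimes> s\<close> to lie in \<open>J\<close>, which is the degree-zero statement
  \<open>J0\<close>. Here \<open>J\<close> is \<open>I\<close> enlarged by \<open>y\<close>,
  described through its elements so that it can be instantiated by \<open>PIdl x\<close> as well as
  by \<open>Idl {x, y}\<close>. The index map \<open>\<phi>\<close> allows denominators such as
  \<open>f [^] p\<close> for data indexed by \<open>f\<close>.\<close>

lemma (in cring) koszul_vanishing1:
  assumes I: "ideal I R" and T: "\<phi> ` T \<subseteq> carrier R"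
    and y: "y \<in> carrier R" "\<And>v. v \<in> carrier R \<Longrightarrow> y \<otimes> v \<in> I \<Longrightarrow> v \<in> I"
    and yN: "y [^] (N::nat) \<in> Idl (\<phi> ` T)"
    and Jd: "\<And>v. v \<in> J \<Longrightarrow> \<exists>i\<in>I. \<exists>r\<in>carrier R. v = i \<oplus> y \<otimes> r"
    and Jy: "\<And>i r. i \<in> I \<Longrightarrow> r \<in> carrier R \<Longrightarrow> i \<oplus> y \<otimes> r \<in> J"
    and J0: "\<And>u. u \<in> carrier R \<Longrightarrow> (\<And>f. f \<in> T \<Longrightarrow> \<phi> f \<otimes> u \<in> J) \<Longrightarrow> u \<in> J"
    and a: "\<And>f. f \<in> T \<Longrightarrow> a f \<in> carrier R"
      "\<And>f g. f \<in> T \<Longrightarrow> g \<in> T \<Longrightarrow> \<phi> g \<otimes> a f \<ominus> \<phi> f \<otimes> a g \<in> I"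
  shows "\<exists>h\<in>carrier R. \<forall>f\<in>T. a f \<ominus> \<phi> f \<otimes> h \<in> I"
proof -
  interpret I: ideal I R by (rule I)
  have Tc: "\<phi> f \<in> carrier R" if "f \<in> T" for f using T that by auto
  define A where "A = {s \<in> carrier R. \<exists>h\<in>carrier R. \<forall>f\<in>T. s \<otimes> a f \<ominus> \<phi> f \<otimes> h \<in> I}"
  have "ideal A R"
  proof (intro cring_idealI)
    have "\<zero> \<otimes> a f \<ominus> \<phi> f \<otimes> \<zero> \<in> I" if "f \<in> T" for f
      using that a(1) Tc by (simp add: minus_eq)
    then show "\<zero> \<in> A" unfolding A_def by blast
  next
    fix s t assume "s \<in> A" "t \<in> A"
    then obtain h k where hk: "s \<in> carrier R" "t \<in> carrier R" "h \<in> carrier R" "k \<in> carrier R"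
      "\<forall>f\<in>T. s \<otimes> a f \<ominus> \<phi> f \<otimes> h \<in> I" "\<forall>f\<in>T. t \<otimes> a f \<ominus> \<phi> f \<otimes> k \<in> I"
      unfolding A_def by blast
    have "(s \<oplus> t) \<otimes> a f \<ominus> \<phi> f \<otimes> (h \<oplus> k) \<in> I" if f: "f \<in> T" for f
    proof -
      have "(s \<otimes> a f \<ominus> \<phi> f \<otimes> h) \<oplus> (t \<otimes> a f \<ominus> \<phi> f \<otimes> k) \<in> I" using hk f by blast
      moreover have "(s \<otimes> a f \<ominus> \<phi> f \<otimes> h) \<oplus> (t \<otimes> a f \<ominus> \<phi> f \<otimes> k) = (s \<oplus> t) \<otimes> a f \<ominus> \<phi> f \<otimes> (h \<oplus> k)"
        using hk(1-4) a(1)[OF f] Tc[OF f] by algebra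
      ultimately show ?thesis by simp
    qed
    then show "s \<oplus> t \<in> A" using hk(1-4) unfolding A_def by blast
  next
    fix s x assume "s \<in> A" and x: "x \<in> carrier R"
    then obtain h where h: "s \<in> carrier R" "h \<in> carrier R" "\<forall>f\<in>T. s \<otimes> a f \<ominus> \<phi> f \<otimes> h \<in> I"
      unfolding A_def by blast
    have "(x \<otimes> s) \<otimes> a f \<ominus> \<phi> f \<otimes> (x \<otimes> h) \<in> I" if f: "f \<in> T" for f
    proof -
      have "x \<otimes> (s \<otimes> a f \<ominus> \<phi> f \<otimes> h) \<in> I" using h f x by (blast intro: I.I_l_closed)
      moreover have "x \<otimes> (s \<otimes> a f \<ominus> \<phi> f \<otimes> h) = (x \<otimes> s) \<otimes> a f \<ominus> \<phi> f \<otimes> (x \<otimes> h)"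
        using h(1,2) x a(1)[OF f] Tc[OF f] by algebra
      ultimately show ?thesis by simp
    qed
    then show "x \<otimes> s \<in> A" using h(1,2) x unfolding A_def by blast
  qed (auto simp: A_def)
  moreover have "\<phi> ` T \<subseteq> A" unfolding A_def using a Tc by blast
  ultimately have TA: "Idl (\<phi> ` T) \<subseteq> A" by (intro genideal_minimal)
  have "\<one> \<in> A"
  proof (rule one_mem_of_power_mem[OF y(1)])
    fix s assume s: "s \<in> carrier R" "y \<otimes> s \<in> A"
    then obtain h where h: "h \<in> carrier R" "\<And>f. f \<in> T \<Longrightarrow> (y \<otimes> s) \<otimes> a f \<ominus> \<phi> f \<otimes> h \<in> I"
      unfolding A_def by blast
    have "h \<in> J"
    proof (rule J0[OF h(1)])
      fix f assume f: "f \<in> T"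
      have "\<ominus> ((y \<otimes> s) \<otimes> a f \<ominus> \<phi> f \<otimes> h) \<oplus> y \<otimes> (s \<otimes> a f) \<in> J"
        using s a(1)[OF f] h(2)[OF f] by (intro Jy) auto
      moreover have "\<ominus> ((y \<otimes> s) \<otimes> a f \<ominus> \<phi> f \<otimes> h) \<oplus> y \<otimes> (s \<otimes> a f) = \<phi> f \<otimes> h"
        using s h(1) y(1) a(1)[OF f] Tc[OF f] by algebra
      ultimately show "\<phi> f \<otimes> h \<in> J" by simp
    qed
    \<comment> \<open>Modulo \<open>I\<close> the witness \<open>h\<close> is a multiple of
      \<open>y\<close>, and its cofactor \<open>k\<close> is the witness for
      \<open>s\<close>.\<close>
    then obtain i k where ik: "i \<in> I" "k \<in> carrier R" "h = i \<oplus> y \<otimes> k" using Jd by blast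
    have "s \<otimes> a f \<ominus> \<phi> f \<otimes> k \<in> I" if f: "f \<in> T" for f
    proof (rule y(2))
      have "((y \<otimes> s) \<otimes> a f \<ominus> \<phi> f \<otimes> h) \<oplus> \<phi> f \<otimes> i \<in> I"
        using h(2)[OF f] ik(1) Tc[OF f] by (simp add: I.I_l_closed)
      moreover have "((y \<otimes> s) \<otimes> a f \<ominus> \<phi> f \<otimes> h) \<oplus> \<phi> f \<otimes> i = y \<otimes> (s \<otimes> a f \<ominus> \<phi> f \<otimes> k)"
        unfolding ik(3) using s(1) y(1) ik(2) I.Icarr[OF ik(1)] a(1)[OF f] Tc[OF f] by algebra
      ultimately show "y \<otimes> (s \<otimes> a f \<ominus> \<phi> f \<otimes> k) \<in> I" by simp
    qed (use s ik(2) a(1)[OF f] Tc[OF f] in simp)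
    then show "s \<in> A" using s(1) ik(2) unfolding A_def by blast
  qed (use TA yN in \<open>auto simp: A_def\<close>)
  then show ?thesis using a(1) by (auto simp: A_def)
qed

text \<open>The multiplier \<open>k \<in> T\<close> is admissible with witness
  \<open>\<lambda>f. u f k\<close>. If \<open>w\<close> is a witness for
  \<open>x \<otimes> s\<close>, then modulo \<open>x\<close> it is a cocycle of degree one, hence
  trivial by \<open>J1\<close>.\<close>

lemma (in cring) koszul_vanishing2:
  assumes T: "T \<subseteq> carrier R"
    and x: "x \<in> carrier R" "\<And>v. v \<in> carrier R \<Longrightarrow> x \<otimes> v = \<zero> \<Longrightarrow> v = \<zero>"
    and xN: "x [^] (N::nat) \<in> Idl T"
    and J1: "\<And>a. (\<And>f. f \<in> T \<Longrightarrow> a f \<in> carrier R) \<Longrightarrow>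
       (\<And>f g. f \<in> T \<Longrightarrow> g \<in> T \<Longrightarrow> g \<otimes> a f \<ominus> f \<otimes> a g \<in> PIdl x) \<Longrightarrow>
       \<exists>h\<in>carrier R. \<forall>f\<in>T. a f \<ominus> f \<otimes> h \<in> PIdl x"
    and u: "\<And>f g. f \<in> T \<Longrightarrow> g \<in> T \<Longrightarrow> u f g \<in> carrier R"
      "\<And>f g k. f \<in> T \<Longrightarrow> g \<in> T \<Longrightarrow> k \<in> T \<Longrightarrow> k \<otimes> u f g = g \<otimes> u f k \<ominus> f \<otimes> u g k"
  shows "\<exists>a. (\<forall>f\<in>T. a f \<in> carrier R) \<and> (\<forall>f\<in>T. \<forall>g\<in>T. u f g = g \<otimes> a f \<ominus> f \<otimes> a g)"
proof -
  have Tc: "f \<in> carrier R" if "f \<in> T" for f using T that by auto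
  define A where "A = {s \<in> carrier R. \<exists>a. (\<forall>f\<in>T. a f \<in> carrier R) \<and>
     (\<forall>f\<in>T. \<forall>g\<in>T. s \<otimes> u f g = g \<otimes> a f \<ominus> f \<otimes> a g)}"
  have "ideal A R"
  proof (intro cring_idealI)
    have "\<zero> \<otimes> u f g = g \<otimes> \<zero> \<ominus> f \<otimes> \<zero>" if "f \<in> T" "g \<in> T" for f g
      using that u(1) Tc by (simp add: minus_eq)
    then show "\<zero> \<in> A" unfolding A_def by (auto intro!: exI[of _ "\<lambda>_. \<zero>"])
  next
    fix s t assume "s \<in> A" "t \<in> A"
    from \<open>s \<in> A\<close> obtain a where a: "s \<in> carrier R" "\<And>f. f \<in> T \<Longrightarrow> a f \<in> carrier R"
      "\<And>f g. f \<in> T \<Longrightarrow> g \<in> T \<Longrightarrow> s \<otimes> u f g = g \<otimes> a f \<ominus> f \<otimes> a g"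
      unfolding A_def by blast
    from \<open>t \<in> A\<close> obtain b where b: "t \<in> carrier R" "\<And>f. f \<in> T \<Longrightarrow> b f \<in> carrier R"
      "\<And>f g. f \<in> T \<Longrightarrow> g \<in> T \<Longrightarrow> t \<otimes> u f g = g \<otimes> b f \<ominus> f \<otimes> b g"
      unfolding A_def by blast
    note s = a(1) b(1) and ab = a(2) b(2) a(3) b(3)
    have "(s \<oplus> t) \<otimes> u f g = g \<otimes> (a f \<oplus> b f) \<ominus> f \<otimes> (a g \<oplus> b g)" if f: "f \<in> T" "g \<in> T" for f g
    proof -
      have "(s \<oplus> t) \<otimes> u f g = (g \<otimes> a f \<ominus> f \<otimes> a g) \<oplus> (g \<otimes> b f \<ominus> f \<otimes> b g)"
        using s u(1)[OF f] by (simp add: l_distr ab f)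
      then show ?thesis
        using f[THEN Tc] f[THEN ab(1)] f[THEN ab(2)] by algebra
    qed
    then show "s \<oplus> t \<in> A" using s ab unfolding A_def
      by (auto intro!: exI[of _ "\<lambda>f. a f \<oplus> b f"])
  next
    fix s y assume "s \<in> A" and y: "y \<in> carrier R"
    then obtain a where s: "s \<in> carrier R" and a: "\<And>f. f \<in> T \<Longrightarrow> a f \<in> carrier R"
      "\<And>f g. f \<in> T \<Longrightarrow> g \<in> T \<Longrightarrow> s \<otimes> u f g = g \<otimes> a f \<ominus> f \<otimes> a g"
      unfolding A_def by blast
    have "(y \<otimes> s) \<otimes> u f g = g \<otimes> (y \<otimes> a f) \<ominus> f \<otimes> (y \<otimes> a g)" if f: "f \<in> T" "g \<in> T" for f g
    proof -
      have "(y \<otimes> s) \<otimes> u f g = y \<otimes> (g \<otimes> a f \<ominus> f \<otimes> a g)"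
        using s y u(1)[OF f] by (simp add: m_assoc a f)
      then show ?thesis
        using f[THEN Tc] f[THEN a(1)] y by algebra
    qed
    then show "y \<otimes> s \<in> A" using s y a unfolding A_def
      by (auto intro!: exI[of _ "\<lambda>f. y \<otimes> a f"])
  qed (auto simp: A_def)
  moreover have "T \<subseteq> A"
  proof
    fix k assume k: "k \<in> T"
    have "\<forall>f\<in>T. \<forall>g\<in>T. k \<otimes> u f g = g \<otimes> u f k \<ominus> f \<otimes> u g k"
      using u(2) k by blast
    moreover have "\<forall>f\<in>T. u f k \<in> carrier R" using k u(1) by blast
    ultimately show "k \<in> A" unfolding A_def using Tc[OF k]
      by (intro CollectI conjI exI[of _ "\<lambda>f. u f k"]) simp_all
  qed
  ultimately have TA: "Idl T \<subseteq> A" by (intro genideal_minimal)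
  have "\<one> \<in> A"
  proof (rule one_mem_of_power_mem[OF x(1)])
    fix s assume s: "s \<in> carrier R" "x \<otimes> s \<in> A"
    then obtain w where w: "\<And>f. f \<in> T \<Longrightarrow> w f \<in> carrier R"
      "\<And>f g. f \<in> T \<Longrightarrow> g \<in> T \<Longrightarrow> (x \<otimes> s) \<otimes> u f g = g \<otimes> w f \<ominus> f \<otimes> w g"
      unfolding A_def by blast
    have "g \<otimes> w f \<ominus> f \<otimes> w g \<in> PIdl x" if f: "f \<in> T" "g \<in> T" for f g
    proof -
      have "g \<otimes> w f \<ominus> f \<otimes> w g = (s \<otimes> u f g) \<otimes> x"
        unfolding w(2)[OF f, symmetric] using s(1) x(1) u(1)[OF f] by algebra
      then show ?thesis unfolding cgenideal_def using s(1) u(1)[OF f] by blast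
    qed
    from J1[OF w(1) this] obtain h where h: "h \<in> carrier R" "\<And>f. f \<in> T \<Longrightarrow> w f \<ominus> f \<otimes> h \<in> PIdl x"
      by blast
    then have "\<forall>f\<in>T. \<exists>r\<in>carrier R. w f \<ominus> f \<otimes> h = r \<otimes> x" unfolding cgenideal_def by blast
    then obtain v where v: "\<And>f. f \<in> T \<Longrightarrow> v f \<in> carrier R" "\<And>f. f \<in> T \<Longrightarrow> w f \<ominus> f \<otimes> h = v f \<otimes> x"
      by metis
    \<comment> \<open>The summand \<open>f \<otimes> h\<close> contributes nothing to
      \<open>g \<otimes> w f \<ominus> f \<otimes> w g\<close>; the rest carries a factor
      \<open>x\<close>, which can be cancelled to leave the witness \<open>v\<close> for
      \<open>s\<close>.\<close>
    have wv: "w f = f \<otimes> h \<oplus> x \<otimes> v f" if f: "f \<in> T" for f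
    proof -
      have "w f = f \<otimes> h \<oplus> (w f \<ominus> f \<otimes> h)" using w(1)[OF f] Tc[OF f] h(1) by algebra
      then show ?thesis using v[OF f] x(1) by (simp add: m_comm)
    qed
    have "s \<otimes> u f g = g \<otimes> v f \<ominus> f \<otimes> v g" if f: "f \<in> T" "g \<in> T" for f g
    proof -
      have "x \<otimes> (s \<otimes> u f g \<ominus> (g \<otimes> v f \<ominus> f \<otimes> v g))
          = (x \<otimes> s) \<otimes> u f g \<ominus> x \<otimes> (g \<otimes> v f \<ominus> f \<otimes> v g)"
        using x(1) s(1) u(1)[OF f] f[THEN v(1)] f[THEN Tc] by algebra
      also have "\<dots> = \<zero>"
        unfolding w(2)[OF f] unfolding wv[OF f(1)] wv[OF f(2)]
        using x(1) h(1) f[THEN v(1)] f[THEN Tc] by algebra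
      finally have "s \<otimes> u f g \<ominus> (g \<otimes> v f \<ominus> f \<otimes> v g) = \<zero>"
        using x(2) s(1) u(1)[OF f] f[THEN v(1)] f[THEN Tc] by simp
      then show ?thesis
        using s(1) u(1)[OF f] f[THEN v(1)] f[THEN Tc] eq_diff0 by simp
    qed
    then show "s \<in> A" using s(1) v(1) unfolding A_def by blast
  qed (use TA xN in \<open>auto simp: A_def\<close>)
  then obtain a where a: "\<forall>f\<in>T. a f \<in> carrier R"
     "\<forall>f\<in>T. \<forall>g\<in>T. \<one> \<otimes> u f g = g \<otimes> a f \<ominus> f \<otimes> a g"
    unfolding A_def by blast
  then show ?thesis using u(1) by (intro exI[of _ a]) auto
qed

section \<open>Noetherian rings\<close>

text \<open>The union of a nonempty chain of ideals is a member of the chain, so Zorn's lemma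
  applies to every nonempty family. Noetherian induction is used in this form throughout.\<close>

lemma (in noetherian_ring) exists_maximal_ideal_in:
  assumes "C \<noteq> {}" "\<And>I. I \<in> C \<Longrightarrow> ideal I R"
  shows "\<exists>M\<in>C. \<forall>I\<in>C. M \<subseteq> I \<longrightarrow> I = M"
proof (rule subset_Zorn_nonempty[OF assms(1)])
  fix D assume D: "D \<noteq> {}" "subset.chain C D"
  then have "subset.chain {I. ideal I R} D"
    using assms(2) unfolding pred_on.chain_def by auto
  then show "\<Union>D \<in> C"
    using ideal_chain_is_trivial[OF D(1)] D(2) unfolding pred_on.chain_def by blast
qed

lemma (in cring) mem_add_cgenideal:
  assumes "a \<in> carrier R"
  shows "v \<in> I <+> PIdl a \<longleftrightarrow> (\<exists>i\<in>I. \<exists>r\<in>carrier R. v = i \<oplus> r \<otimes> a)"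
  using assms unfolding set_add_def' cgenideal_def by auto

lemma (in cring) ideal_add_cgenideal:
  assumes I: "ideal I R" and a: "a \<in> carrier R"
  shows "ideal (I <+> PIdl a) R" "I \<subseteq> I <+> PIdl a" "a \<in> I <+> PIdl a"
proof -
  interpret I: ideal I R by (rule I)
  show "ideal (I <+> PIdl a) R" using assms add_ideals cgenideal_ideal by blast
  have "i = i \<oplus> \<zero> \<otimes> a" if "i \<in> I" for i using a I.Icarr[OF that] by simp
  then show "I \<subseteq> I <+> PIdl a" unfolding subset_iff mem_add_cgenideal[OF a] by blast
  have "a = \<zero> \<oplus> \<one> \<otimes> a" using a by simp
  then show "a \<in> I <+> PIdl a" unfolding mem_add_cgenideal[OF a] using I.zero_closed by blast
qed

text \<open>An ideal maximal among those containing \<open>I\<close> and missing all powers of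
  \<open>x\<close> is prime: enlarging it by \<open>a\<close> and by \<open>b\<close> captures two
  powers of \<open>x\<close>, and their product lies in the ideal as soon as
  \<open>a \<otimes> b\<close> does.\<close>

lemma (in cring) noetherian_prime_avoiding:
  assumes N: "noetherian_ring R" and I: "ideal I R" and x: "x \<in> carrier R" "\<And>n::nat. x [^] n \<notin> I"
  shows "\<exists>Q. primeideal Q R \<and> I \<subseteq> Q \<and> x \<notin> Q"
proof -
  interpret noetherian_ring R by (rule N)
  define C where "C = {L. ideal L R \<and> I \<subseteq> L \<and> (\<forall>n::nat. x [^] n \<notin> L)}"
  have "I \<in> C" using assms by (auto simp: C_def)
  moreover have "\<And>L. L \<in> C \<Longrightarrow> ideal L R" by (simp add: C_def)
  ultimately obtain Q where Q: "Q \<in> C" "\<And>L. L \<in> C \<Longrightarrow> Q \<subseteq> L \<Longrightarrow> L = Q"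
    using exists_maximal_ideal_in[of C] by (metis empty_iff)
  then have Qi: "ideal Q R" and IQ: "I \<subseteq> Q" and xQ: "\<And>n::nat. x [^] n \<notin> Q" by (auto simp: C_def)
  interpret Q: ideal Q R by (rule Qi)
  have big: "\<exists>n::nat. \<exists>i\<in>Q. \<exists>r\<in>carrier R. x [^] n = i \<oplus> r \<otimes> a" if a: "a \<in> carrier R" "a \<notin> Q" for a
  proof (rule ccontr)
    assume "\<not> ?thesis"
    then have "Q <+> PIdl a \<in> C"
      unfolding C_def using ideal_add_cgenideal[OF Qi a(1)] IQ by (auto simp: mem_add_cgenideal[OF a(1)])
    then have "Q <+> PIdl a = Q"
      using Q(2) ideal_add_cgenideal[OF Qi a(1)] by blast
    then show False using ideal_add_cgenideal(3)[OF Qi a(1)] a(2) by simp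
  qed
  have "primeideal Q R"
  proof (rule primeidealI[OF Qi is_cring])
    show "carrier R \<noteq> Q" using xQ[of 0] by auto
    fix a b assume a: "a \<in> carrier R" "b \<in> carrier R" "a \<otimes> b \<in> Q"
    show "a \<in> Q \<or> b \<in> Q"
    proof (rule ccontr)
      assume "\<not> (a \<in> Q \<or> b \<in> Q)"
      then obtain n n' :: nat and i r i' r' where h: "i \<in> Q" "r \<in> carrier R" "x [^] n = i \<oplus> r \<otimes> a"
        "i' \<in> Q" "r' \<in> carrier R" "x [^] n' = i' \<oplus> r' \<otimes> b"
        using big[of a] big[of b] a by metis
      have "x [^] (n + n') = (i \<oplus> r \<otimes> a) \<otimes> (i' \<oplus> r' \<otimes> b)"
        using x(1) h by (simp flip: nat_pow_mult)
      also have "\<dots> = ((i' \<oplus> r' \<otimes> b) \<otimes> i \<oplus> (r \<otimes> a) \<otimes> i') \<oplus> (r \<otimes> r') \<otimes> (a \<otimes> b)"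
        using a(1,2) h(2,5) Q.Icarr[OF h(1)] Q.Icarr[OF h(4)] by algebra
      also have "\<dots> \<in> Q"
        using a h Q.Icarr by (auto intro!: Q.a_closed Q.I_l_closed)
      finally show False using xQ by blast
    qed
  qed
  then show ?thesis using IQ xQ[of 1] x(1) by (auto intro!: exI[of _ Q])
qed

lemma (in cring) exists_minimal_prime_below:
  assumes Q: "primeideal Q R"
  shows "\<exists>Q0. minimal_prime R Q0 \<and> Q0 \<subseteq> Q"
proof -
  \<comment> \<open>Zorn's lemma yields maximal elements; passing to complements turns them into
    minimal primes. The work is that the intersection of a chain of primes is prime.\<close>
  define C where "C = (\<lambda>P. carrier R - P) ` {P. primeideal P R \<and> P \<subseteq> Q}"
  have sub: "P \<subseteq> carrier R" if "primeideal P R" for P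
    using ideal.Icarr[OF primeideal.axioms(1)[OF that]] by blast
  have "\<exists>M\<in>C. \<forall>L\<in>C. M \<subseteq> L \<longrightarrow> L = M"
  proof (rule subset_Zorn_nonempty)
    show "C \<noteq> {}" using Q by (auto simp: C_def)
    fix D assume D: "D \<noteq> {}" "subset.chain C D"
    define F where "F = {P. primeideal P R \<and> P \<subseteq> Q \<and> carrier R - P \<in> D}"
    have DC: "D \<subseteq> C" and Dtot: "\<And>A B. A \<in> D \<Longrightarrow> B \<in> D \<Longrightarrow> A \<subseteq> B \<or> B \<subseteq> A"
      using D(2) unfolding pred_on.chain_def by blast+
    have DF: "D = (\<lambda>P. carrier R - P) ` F"
      using DC unfolding F_def C_def by blast
    have ne: "F \<noteq> {}" using D(1) DF by auto
    have tot: "P \<subseteq> P' \<or> P' \<subseteq> P" if "P \<in> F" "P' \<in> F" for P P'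
    proof -
      have "carrier R - P \<subseteq> carrier R - P' \<or> carrier R - P' \<subseteq> carrier R - P"
        using Dtot that unfolding F_def by blast
      then show ?thesis using that sub unfolding F_def by blast
    qed
    have Fp: "primeideal P R" if "P \<in> F" for P using that by (simp add: F_def)
    have "primeideal (\<Inter>F) R"
    proof (rule primeidealI)
      show "ideal (\<Inter>F) R" using ne Fp primeideal.axioms(1) by (intro i_Intersect) blast+
      obtain P0 where P0: "P0 \<in> F" using ne by blast
      have "\<one> \<notin> P0" using Fp[OF P0] primeideal.I_notcarr ideal.one_imp_carrier primeideal.axioms(1) by metis
      then show "carrier R \<noteq> \<Inter>F" using P0 one_closed by blast
      fix a b assume ab: "a \<in> carrier R" "b \<in> carrier R" "a \<otimes> b \<in> \<Inter>F"
      show "a \<in> \<Inter>F \<or> b \<in> \<Inter>F"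
      proof (rule ccontr)
        assume "\<not> ?thesis"
        then obtain P P' where P: "P \<in> F" "P' \<in> F" "a \<notin> P" "b \<notin> P'" by blast
        then obtain P'' where "P'' \<in> F" "a \<notin> P''" "b \<notin> P''" using tot[OF P(1,2)] by blast
        then show False using ab Fp primeideal.I_prime by (metis InterE)
      qed
    qed (rule is_cring)
    moreover have "\<Inter>F \<subseteq> Q" using ne unfolding F_def by blast
    moreover have "\<Union>D = carrier R - \<Inter>F" unfolding DF by blast
    ultimately show "\<Union>D \<in> C" unfolding C_def by blast
  qed
  then obtain P where P: "primeideal P R" "P \<subseteq> Q"
    "\<And>P'. primeideal P' R \<Longrightarrow> P' \<subseteq> Q \<Longrightarrow> carrier R - P \<subseteq> carrier R - P' \<Longrightarrow> carrier R - P' = carrier R - P"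
    unfolding C_def by auto
  have "P' = P" if "primeideal P' R" "P' \<subseteq> P" for P'
    using P(3)[OF that(1)] that P(1,2) sub[OF that(1)] sub[OF P(1)] by blast
  then show ?thesis using P(1,2) unfolding minimal_prime_def by blast
qed

section \<open>Powers of ideals\<close>

lemma (in cring) ideal_pow_ideal: "ideal I R \<Longrightarrow> ideal (ideal_pow R I n) R"
  by (induction n) (simp_all add: oneideal ideal_prod_is_ideal)

lemma (in cring) ideal_pow_add:
  "ideal I R \<Longrightarrow> ideal_pow R I (k + l) = ideal_prod R (ideal_pow R I k) (ideal_pow R I l)"
proof (induction k)
  case 0
  then show ?case
    using ideal_prod_commute[OF oneideal ideal_pow_ideal] ideal_prod_one ideal_pow_ideal by simp
qed (simp add: ideal_prod_assoc ideal_pow_ideal)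

lemma (in cring) ideal_prod_subset:
  assumes "ideal L R" "ideal I R" "ideal J R" "\<And>i j. i \<in> I \<Longrightarrow> j \<in> J \<Longrightarrow> i \<otimes> j \<in> L"
  shows "ideal_prod R I J \<subseteq> L"
proof -
  interpret L: ideal L R by fact
  have "v \<in> L" if "v \<in> ideal_prod R I J" for v
    using that by induction (auto simp: assms(4))
  then show ?thesis by blast
qed

lemma (in cring) ideal_pow_mem:
  assumes "ideal I R" "x \<in> I" shows "x [^] (n::nat) \<in> ideal_pow R I n"
proof (induction n)
  case (Suc n)
  have x: "x \<in> carrier R" using assms ideal.Icarr by fast
  then have "x [^] Suc n = x \<otimes> x [^] n" by (simp add: m_comm)
  also have "\<dots> \<in> ideal_prod R I (ideal_pow R I n)"
    using Suc assms(2) by (rule ideal_prod.prod[rotated])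
  finally show ?case by simp
qed simp

text \<open>An ideal \<open>Q\<close> maximal among those above \<open>L\<close> that contain no
  power of \<open>I\<close> is prime, since powers inside \<open>Q\<close> enlarged by
  \<open>a\<close> and by \<open>b\<close> multiply to a power inside \<open>Q\<close> enlarged by
  \<open>a \<otimes> b\<close>. A prime above \<open>L\<close> contains \<open>I\<close> by
  \<open>pw\<close>, which is a contradiction. No generators of \<open>I\<close> have to be
  counted.\<close>

lemma (in cring) noetherian_ideal_pow_subset:
  assumes N: "noetherian_ring R" and I: "ideal I R" and L: "ideal L R"
    and pw: "\<And>x. x \<in> I \<Longrightarrow> \<exists>n::nat. x [^] n \<in> L"
  shows "\<exists>k. ideal_pow R I k \<subseteq> L"
proof (rule ccontr)
  assume neg: "\<not> ?thesis"
  interpret noetherian_ring R by (rule N)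
  define C where "C = {L'. ideal L' R \<and> L \<subseteq> L' \<and> (\<forall>k. \<not> ideal_pow R I k \<subseteq> L')}"
  have "L \<in> C" using neg L by (auto simp: C_def)
  moreover have "\<And>L. L \<in> C \<Longrightarrow> ideal L R" by (simp add: C_def)
  ultimately obtain Q where Q: "Q \<in> C" "\<And>L. L \<in> C \<Longrightarrow> Q \<subseteq> L \<Longrightarrow> L = Q"
    using exists_maximal_ideal_in[of C] by (metis empty_iff)
  then have Qi: "ideal Q R" and LQ: "L \<subseteq> Q" and IQ: "\<And>k. \<not> ideal_pow R I k \<subseteq> Q" by (auto simp: C_def)
  interpret Q: ideal Q R by (rule Qi)
  have big: "\<exists>k. ideal_pow R I k \<subseteq> Q <+> PIdl a" if a: "a \<in> carrier R" "a \<notin> Q" for a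
  proof (rule ccontr)
    assume "\<not> ?thesis"
    then have "Q <+> PIdl a \<in> C"
      unfolding C_def using ideal_add_cgenideal[OF Qi a(1)] LQ by auto
    then have "Q <+> PIdl a = Q"
      using Q(2) ideal_add_cgenideal[OF Qi a(1)] by blast
    then show False using ideal_add_cgenideal(3)[OF Qi a(1)] a(2) by simp
  qed
  have pr: "a \<in> Q \<or> b \<in> Q" if a: "a \<in> carrier R" "b \<in> carrier R" "a \<otimes> b \<in> Q" for a b
  proof (rule ccontr)
    assume "\<not> (a \<in> Q \<or> b \<in> Q)"
    then obtain k l where kl: "ideal_pow R I k \<subseteq> Q <+> PIdl a" "ideal_pow R I l \<subseteq> Q <+> PIdl b"
      using big a by metis
    have "ideal_pow R I (k + l) \<subseteq> Q" unfolding ideal_pow_add[OF I]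
    proof (rule ideal_prod_subset[OF Qi ideal_pow_ideal[OF I] ideal_pow_ideal[OF I]])
      fix v w assume "v \<in> ideal_pow R I k" "w \<in> ideal_pow R I l"
      then obtain i r i' r' where h: "i \<in> Q" "r \<in> carrier R" "v = i \<oplus> r \<otimes> a"
        "i' \<in> Q" "r' \<in> carrier R" "w = i' \<oplus> r' \<otimes> b"
        using kl mem_add_cgenideal a by (metis subsetD)
      have "v \<otimes> w = ((i' \<oplus> r' \<otimes> b) \<otimes> i \<oplus> (r \<otimes> a) \<otimes> i') \<oplus> (r \<otimes> r') \<otimes> (a \<otimes> b)"
        unfolding h(3,6) using a(1,2) h(2,5) Q.Icarr[OF h(1)] Q.Icarr[OF h(4)] by algebra
      also have "\<dots> \<in> Q"
        using a h Q.Icarr by (auto intro!: Q.a_closed Q.I_l_closed)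
      finally show "v \<otimes> w \<in> Q" .
    qed
    then show False using IQ by blast
  qed
  have "x \<in> Q" if x: "x \<in> I" for x
  proof -
    have xc: "x \<in> carrier R" using x I ideal.Icarr by fast
    obtain n :: nat where "x [^] n \<in> Q" using pw[OF x] LQ by blast
    then show ?thesis
    proof (induction n)
      case 0
      then show ?case using IQ[of 0] Q.one_imp_carrier by simp
    next
      case (Suc n)
      then show ?case using pr[of "x [^] n" x] xc by auto
    qed
  qed
  then show False using IQ[of 1] ideal_prod_one[OF I] by auto
qed

section \<open>Krull intersection, Frobenius and Artin--Schreier equations\<close>

lemma (in cring) local_ring_unit:
  assumes N: "noetherian_ring R" and L: "local_ring R m" and x: "x \<in> carrier R" "x \<notin> m"
  shows "\<exists>y\<in>carrier R. x \<otimes> y = \<one>"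
proof (rule ccontr)
  assume neg: "\<not> ?thesis"
  interpret noetherian_ring R by (rule N)
  define C where "C = {L. ideal L R \<and> PIdl x \<subseteq> L \<and> \<one> \<notin> L}"
  have "\<one> \<notin> PIdl x" using neg x m_comm unfolding cgenideal_def by force
  then have "PIdl x \<in> C" using cgenideal_ideal[OF x(1)] by (auto simp: C_def)
  moreover have "\<And>L. L \<in> C \<Longrightarrow> ideal L R" by (simp add: C_def)
  ultimately obtain M where M: "M \<in> C" "\<And>L. L \<in> C \<Longrightarrow> M \<subseteq> L \<Longrightarrow> L = M"
    using exists_maximal_ideal_in[of C] by (metis empty_iff)
  have "maximalideal M R"
  proof (rule maximalidealI)
    show "ideal M R" "carrier R \<noteq> M" using M(1) by (auto simp: C_def)
    fix J assume J: "ideal J R" "M \<subseteq> J"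
    show "J = M \<or> J = carrier R"
    proof (cases "\<one> \<in> J")
      case True
      then show ?thesis using ideal.one_imp_carrier[OF J(1)] by blast
    next
      case False
      then have "J \<in> C" using J M(1) by (auto simp: C_def)
      then show ?thesis using M(2) J(2) by blast
    qed
  qed
  then have "M = m" using L unfolding local_ring_def by blast
  then show False using M(1) cgenideal_self[OF x(1)] x(2) by (auto simp: C_def)
qed

text \<open>Let \<open>B\<close> be \<open>a\<close> times \<open>m\<close>, and let
  \<open>M\<close> be maximal among the ideals above \<open>B\<close> that meet the principal ideal
  of \<open>a\<close> only inside \<open>B\<close>. Every element of \<open>m\<close> has a power in
  \<open>M\<close>, so \<open>M\<close> contains a power of \<open>m\<close> and hence
  \<open>a\<close>. Thus \<open>a\<close> lies in \<open>B\<close>, and a unit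
  \<open>\<one> \<ominus> t\<close> annihilates it.\<close>

lemma (in cring) krull_intersection:
  assumes N: "noetherian_ring R" and L: "local_ring R m"
    and a: "\<And>n. a \<in> ideal_pow R m n"
  shows "a = \<zero>"
proof -
  interpret noetherian_ring R by (rule N)
  have "maximalideal m R" using L by (simp add: local_ring_def)
  then interpret m: maximalideal m R .
  have mi: "ideal m R" by (rule m.ideal_axioms)
  have ac: "a \<in> carrier R" using a[of 0] by simp
  define B where "B = (\<lambda>t. a \<otimes> t) ` m"
  have Bi: "ideal B R"
  proof (rule cring_idealI)
    show "B \<subseteq> carrier R" using ac m.Icarr by (auto simp: B_def)
    show "\<zero> \<in> B" using ac by (auto simp: B_def intro!: image_eqI[of _ _ \<zero>])
    show "\<And>b c. b \<in> B \<Longrightarrow> c \<in> B \<Longrightarrow> b \<oplus> c \<in> B"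
      using ac m.Icarr by (auto simp: B_def r_distr[symmetric] intro!: imageI)
    show "\<And>b x. b \<in> B \<Longrightarrow> x \<in> carrier R \<Longrightarrow> x \<otimes> b \<in> B"
      using ac m.Icarr by (auto simp: B_def m_lcomm[of _ a] intro!: imageI m.I_l_closed)
  qed
  have pB: "x \<otimes> y \<in> B" if xm: "x \<in> m" and y: "y \<in> PIdl a" for x y
  proof -
    obtain r where r: "r \<in> carrier R" "y = r \<otimes> a" using y by (auto simp: cgenideal_def)
    have "x \<otimes> y = a \<otimes> (x \<otimes> r)" unfolding r(2) using r(1) ac m.Icarr[OF xm] by algebra
    then show ?thesis using m.I_r_closed[OF xm r(1)] unfolding B_def by blast
  qed
  define C where "C = {L. ideal L R \<and> B \<subseteq> L \<and> L \<inter> PIdl a \<subseteq> B}"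
  have "B \<in> C" using Bi by (auto simp: C_def)
  moreover have "\<And>L. L \<in> C \<Longrightarrow> ideal L R" by (simp add: C_def)
  ultimately obtain M where M: "M \<in> C" "\<And>L. L \<in> C \<Longrightarrow> M \<subseteq> L \<Longrightarrow> L = M"
    using exists_maximal_ideal_in[of C] by (metis empty_iff)
  have Mi: "ideal M R" and BM: "B \<subseteq> M" and MB: "M \<inter> PIdl a \<subseteq> B" using M(1) by (auto simp: C_def)
  interpret M: ideal M R by (rule Mi)
  have "\<exists>n::nat. x [^] n \<in> M" if xm: "x \<in> m" for x
  proof -
    have x: "x \<in> carrier R" using m.Icarr[OF xm] .
    define Q where "Q n = {r \<in> carrier R. x [^] (n::nat) \<otimes> r \<in> M}" for n
    have Qi: "ideal (Q n) R" for n
      unfolding Q_def by (rule M.helper_max_prime[OF is_cring]) (use x in simp)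
    \<comment> \<open>The ideals \<open>Q n\<close> are the quotients of \<open>M\<close> by
      \<open>x [^] n\<close> and ascend, so they become stationary. At this \<open>n\<close>, adding
      \<open>x [^] n\<close> to \<open>M\<close> does not enlarge the intersection with the
      principal ideal of \<open>a\<close>, and maximality puts \<open>x [^] n\<close> into
      \<open>M\<close>.\<close>
    obtain n where n: "\<And>k. Q n \<subseteq> Q k \<Longrightarrow> Q k = Q n"
      using exists_maximal_ideal_in[of "range Q"] Qi by auto
    have "Q n \<subseteq> Q (Suc n)"
    proof
      fix r assume "r \<in> Q n"
      then have r: "r \<in> carrier R" "x [^] n \<otimes> r \<in> M" by (auto simp: Q_def)
      have "x [^] Suc n \<otimes> r = x \<otimes> (x [^] n \<otimes> r)" using x r(1) by (simp add: m_ac)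
      then show "r \<in> Q (Suc n)" using r M.I_l_closed[OF r(2) x] by (simp add: Q_def)
    qed
    from n[OF this] have stab: "x [^] n \<otimes> r \<in> M" if "r \<in> carrier R" "x [^] Suc n \<otimes> r \<in> M" for r
      using that by (auto simp: Q_def)
    have xn: "x [^] n \<in> carrier R" using x by simp
    have "(M <+> PIdl (x [^] n)) \<inter> PIdl a \<subseteq> B"
    proof
      fix y assume y: "y \<in> (M <+> PIdl (x [^] n)) \<inter> PIdl a"
      then obtain i r where ir: "i \<in> M" "r \<in> carrier R" "y = i \<oplus> r \<otimes> x [^] n"
        using mem_add_cgenideal[OF xn] by blast
      have "x [^] Suc n \<otimes> r = x \<otimes> y \<ominus> x \<otimes> i"
        unfolding ir(3) using x xn ir(2) M.Icarr[OF ir(1)] unfolding nat_pow_Suc by algebra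
      also have "\<dots> \<in> M"
        using pB[OF xm] y BM M.I_l_closed[OF ir(1) x] by (auto simp: minus_eq)
      finally have "x [^] n \<otimes> r \<in> M" using stab ir(2) by blast
      then have "y \<in> M" unfolding ir(3) using ir(1,2) xn by (simp add: m_comm)
      then show "y \<in> B" using MB y by blast
    qed
    then have "M <+> PIdl (x [^] n) \<in> C"
      using ideal_add_cgenideal[OF Mi xn] BM by (auto simp: C_def)
    then show ?thesis using M(2) ideal_add_cgenideal[OF Mi xn] by blast
  qed
  then obtain k where "ideal_pow R m k \<subseteq> M"
    using noetherian_ideal_pow_subset[OF N mi Mi] by blast
  then have "a \<in> B" using a[of k] MB cgenideal_self[OF ac] by blast
  then obtain t where t: "t \<in> m" "a = a \<otimes> t" by (auto simp: B_def)
  have tc: "t \<in> carrier R" using m.Icarr[OF t(1)] .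
  have "\<one> \<ominus> t \<notin> m"
  proof
    assume "\<one> \<ominus> t \<in> m"
    then have "(\<one> \<ominus> t) \<oplus> t \<in> m" using t(1) by blast
    moreover have "(\<one> \<ominus> t) \<oplus> t = \<one>" using tc by algebra
    ultimately show False using m.one_imp_carrier m.I_notcarr by simp
  qed
  then obtain y where y: "y \<in> carrier R" "(\<one> \<ominus> t) \<otimes> y = \<one>"
    using local_ring_unit[OF N L, of "\<one> \<ominus> t"] tc by auto
  have "a = a \<otimes> ((\<one> \<ominus> t) \<otimes> y)" using ac y(2) by simp
  also have "\<dots> = (a \<ominus> a \<otimes> t) \<otimes> y" using ac tc y(1) by algebra
  also have "\<dots> = \<zero>" using ac y(1) t(2)[symmetric] by (simp add: minus_eq r_neg)
  finally show ?thesis .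
qed

section \<open>Images of integers and the Frobenius map in characteristic p\<close>

lemma (in ring) of_integer_add_pow: "add_pow R n \<one> = \<guillemotleft>int n\<guillemotright>"
proof (induction n)
  case (Suc n)
  have "\<guillemotleft>int (Suc n)\<guillemotright> = \<guillemotleft>1 + int n\<guillemotright>" by simp
  then show ?case using Suc by (simp del: of_nat_Suc add: a_comm)
qed simp

text \<open>By Bezout an integer prime to \<open>p\<close> becomes a unit, and a proper ideal
  contains no unit. Congruences modulo \<open>p\<close> can therefore be tested at any prime
  ideal.\<close>

lemma (in cring) of_integer_mem_primeideal:
  assumes p: "Factorial_Ring.prime p" and ch: "has_char R p" and Q: "primeideal Q R"
  shows "\<guillemotleft>i\<guillemotright> \<in> Q \<longleftrightarrow> int p dvd i"
proof -
  interpret Q: primeideal Q R by (rule Q)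
  have p0: "\<guillemotleft>int p\<guillemotright> = \<zero>" using ch by (simp add: has_char_def of_integer_add_pow)
  show ?thesis
  proof
    assume "int p dvd i"
    then obtain k where "i = int p * k" by blast
    then show "\<guillemotleft>i\<guillemotright> \<in> Q" by (simp add: p0)
  next
    assume iQ: "\<guillemotleft>i\<guillemotright> \<in> Q"
    show "int p dvd i"
    proof (rule ccontr)
      assume "\<not> int p dvd i"
      then have "coprime (int p) i" using p by (intro prime_imp_coprime) auto
      then obtain u v where "u * int p + v * i = 1" using bezout_int[of "int p" i] by auto
      then have "\<guillemotleft>u * int p + v * i\<guillemotright> = \<one>" by simp
      then have "\<guillemotleft>v\<guillemotright> \<otimes> \<guillemotleft>i\<guillemotright> = \<one>" by (simp add: p0)
      moreover have "\<guillemotleft>v\<guillemotright> \<otimes> \<guillemotleft>i\<guillemotright> \<in> Q" using iQ by (simp add: Q.I_l_closed)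
      ultimately show False using Q.one_imp_carrier Q.I_notcarr by simp
    qed
  qed
qed

lemma (in cring) of_integer_char:
  assumes "has_char R p" "int p dvd i"
  shows "\<guillemotleft>i\<guillemotright> = \<zero>"
proof -
  obtain k where "i = int p * k" using assms by blast
  then show ?thesis using assms by (simp add: has_char_def of_integer_add_pow)
qed

lemma (in cring) binomial_expansion:
  assumes a: "a \<in> carrier R" and b: "b \<in> carrier R"
  shows "(a \<oplus> b) [^] (n::nat) = (\<Oplus>k\<in>{..n}. \<guillemotleft>int (n choose k)\<guillemotright> \<otimes> (a [^] k \<otimes> b [^] (n - k)))"
proof (induction n)
  case 0
  then show ?case by simp
next
  case (Suc n)
  let ?c = "\<lambda>k. \<guillemotleft>int (n choose k)\<guillemotright>"
  have A: "a \<otimes> (a \<oplus> b) [^] n = (\<Oplus>k\<in>{..n}. ?c k \<otimes> (a [^] Suc k \<otimes> b [^] (n - k)))"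
    unfolding Suc by (subst finsum_rdistr, use a b in \<open>simp_all add: Pi_def\<close>,
      intro finsum_cong', use a b in \<open>auto simp: m_ac\<close>)
  have "b \<otimes> (a \<oplus> b) [^] n = (\<Oplus>k\<in>{..n}. ?c k \<otimes> (a [^] k \<otimes> b [^] (Suc n - k)))"
    unfolding Suc by (subst finsum_rdistr, use a b in \<open>simp_all add: Pi_def\<close>,
      intro finsum_cong', use a b in \<open>auto simp: m_ac Suc_diff_le\<close>)
  also have "\<dots> = (\<Oplus>k\<in>{..Suc n}. ?c k \<otimes> (a [^] k \<otimes> b [^] (Suc n - k)))"
    using a b by (subst finsum_Suc) (simp_all add: Pi_def binomial_eq_0 finsum_closed)
  also have "\<dots> = (\<Oplus>k\<in>{..n}. ?c (Suc k) \<otimes> (a [^] Suc k \<otimes> b [^] (n - k))) \<oplus> b [^] Suc n"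
    using a b by (subst finsum_Suc2) (simp_all add: Pi_def)
  finally have B: "b \<otimes> (a \<oplus> b) [^] n = \<dots>" .
  have "(a \<oplus> b) [^] Suc n = a \<otimes> (a \<oplus> b) [^] n \<oplus> b \<otimes> (a \<oplus> b) [^] n"
    using a b by (simp add: m_comm[of "(a \<oplus> b) [^] n"] l_distr)
  also have "\<dots> = (\<Oplus>k\<in>{..n}. ?c k \<otimes> (a [^] Suc k \<otimes> b [^] (n - k)))
      \<oplus> (\<Oplus>k\<in>{..n}. ?c (Suc k) \<otimes> (a [^] Suc k \<otimes> b [^] (n - k))) \<oplus> b [^] Suc n"
    unfolding A B using a b by (simp add: a_assoc finsum_closed Pi_def)
  also have "\<dots> = (\<Oplus>k\<in>{..n}. \<guillemotleft>int (Suc n choose Suc k)\<guillemotright> \<otimes> (a [^] Suc k \<otimes> b [^] (n - k))) \<oplus> b [^] Suc n"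
    using a b by (subst finsum_addf[symmetric]) (simp_all add: Pi_def l_distr)
  also have "\<dots> = (\<Oplus>k\<in>{..Suc n}. \<guillemotleft>int (Suc n choose k)\<guillemotright> \<otimes> (a [^] k \<otimes> b [^] (Suc n - k)))"
    using a b by (subst finsum_Suc2) (simp_all add: Pi_def)
  finally show ?case .
qed

lemma (in cring) frobenius_add:
  assumes p: "Factorial_Ring.prime p" and ch: "has_char R p"
    and a: "a \<in> carrier R" and b: "b \<in> carrier R"
  shows "(a \<oplus> b) [^] p = a [^] p \<oplus> b [^] p"
proof -
  obtain q where q: "p = Suc (Suc q)" using prime_ge_2_nat[OF p] by (metis Suc_le_D numeral_2_eq_2 Suc_le_mono)
  let ?t = "\<lambda>k. \<guillemotleft>int (p choose k)\<guillemotright> \<otimes> (a [^] k \<otimes> b [^] (p - k))"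
  have z: "\<guillemotleft>int (p choose k)\<guillemotright> = \<zero>" if "0 < k" "k < p" for k
    using that p by (intro of_integer_char[OF ch]) (simp add: dvd_choose_prime)
  have "(a \<oplus> b) [^] p = (\<Oplus>k\<in>{..Suc (Suc q)}. ?t k)"
    using binomial_expansion[OF a b, of p] q by simp
  also have "\<dots> = ?t (Suc (Suc q)) \<oplus> ((\<Oplus>k\<in>{..q}. ?t (Suc k)) \<oplus> ?t 0)"
    using a b by (subst finsum_Suc, simp add: Pi_def, subst finsum_Suc2) (simp_all add: Pi_def)
  also have "(\<Oplus>k\<in>{..q}. ?t (Suc k)) = (\<Oplus>k\<in>{..q}. \<zero>)"
  proof (intro finsum_cong')
    fix i assume "i \<in> {..q}"
    then have "\<guillemotleft>int (p choose Suc i)\<guillemotright> = \<zero>" using z[of "Suc i"] q by simp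
    then show "?t (Suc i) = \<zero>" using a b by simp
  qed auto
  finally show ?thesis using a b q by (simp add: finsum_zero)
qed

lemma (in cring) frobenius_diff:
  assumes p: "Factorial_Ring.prime p" and ch: "has_char R p"
    and a: "a \<in> carrier R" and b: "b \<in> carrier R"
  shows "(a \<ominus> b) [^] p = a [^] p \<ominus> b [^] p"
proof -
  have "(a \<ominus> b) \<oplus> b = a" using a b by algebra
  then have "a [^] p = (a \<ominus> b) [^] p \<oplus> b [^] p"
    using frobenius_add[OF p ch, of "a \<ominus> b" b] a b by simp
  moreover have "((a \<ominus> b) [^] p \<oplus> b [^] p) \<ominus> b [^] p = (a \<ominus> b) [^] p"
    using a b minus_closed nat_pow_closed by algebra
  ultimately show ?thesis by simp
qed


section \<open>Counting roots and solving Artin-Schreier equations\<close>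

lemma (in domain) card_roots_le_degree:
  assumes "f \<in> carrier (poly_ring R)" "f \<noteq> []"
  shows "card {x. is_root f x} \<le> degree f"
  using assms
proof (induction "degree f" arbitrary: f)
  case 0
  then show ?case by (simp add: degree_zero_imp_not_is_root)
next
  case (Suc n)
  interpret UP: domain "poly_ring R"
    using univ_poly_is_domain[OF carrier_is_subring] .
  show ?case
  proof (cases "{x. is_root f x} = {}")
    case False
    then obtain a where a: "is_root f a" by blast
    then have ac: "a \<in> carrier R" by (simp add: is_root_def)
    have l: "[\<one>, \<ominus> a] \<in> carrier (poly_ring R)"
      using ac unfolding univ_poly_carrier[symmetric] polynomial_def by simp
    obtain q where q: "q \<in> carrier (poly_ring R)" "f = [\<one>, \<ominus> a] \<otimes>\<^bsub>poly_ring R\<^esub> q"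
      using is_root_imp_pdivides[OF Suc.prems(1) a] unfolding pdivides_def by auto
    have qne: "q \<noteq> []"
      using q(2) Suc.prems(2) UP.r_null[OF l] unfolding univ_poly_zero by auto
    have "degree f = 1 + degree q"
      using poly_mult_degree_eq[OF carrier_is_subring, of "[\<one>, \<ominus> a]" q] l q qne
      unfolding univ_poly_carrier univ_poly_mult by simp
    then have n: "n = degree q" using Suc.hyps(2) by simp
    have "{x. is_root f x} \<subseteq> insert a {x. is_root q x}"
      using is_root_poly_mult_imp_is_root[OF l q(1)] monic_degree_one_root_condition[OF ac]
      unfolding q(2) by auto
    then have "card {x. is_root f x} \<le> card (insert a {x. is_root q x})"
      using finite_number_of_roots[OF q(1)] by (intro card_mono) auto
    also have "\<dots> \<le> Suc (card {x. is_root q x})"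
      by (rule card_insert_le_m1) auto
    finally show ?thesis
      using Suc.hyps(1)[OF n q(1) qne] Suc.hyps(2) n by simp
  qed (simp only: card.empty)
qed

lemma (in ring) eval_trinomial:
  assumes "b \<in> carrier R" "c \<in> carrier R" "x \<in> carrier R"
  shows "eval (\<one> # replicate k \<zero> @ [b, c]) x = x [^] (k + 2) \<oplus> (b \<otimes> x \<oplus> c)"
proof -
  have "eval (replicate k \<zero> @ [b, c]) x = b \<otimes> x \<oplus> c"
    using assms by (induction k) auto
  then show ?thesis using assms by simp
qed

lemma dvd_power_minus_self:
  assumes p: "Factorial_Ring.prime p"
  shows "int p dvd i ^ p - i"
proof -
  obtain t :: nat where t: "[i = int t] (mod int p)"
    using p by (intro that[of "nat (i mod int p)"]) (simp add: cong_def prime_gt_0_nat)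
  have "[int t ^ p = int t] (mod int p)"
  proof (cases "p dvd t")
    case True
    then have "int p dvd int t" by simp
    moreover from this have "int p dvd int t ^ p"
      using prime_gt_0_nat[OF p] by (metis dvd_power dvd_trans)
    ultimately show ?thesis by (simp add: cong_def)
  next
    case False
    have "[t ^ (p - 1) * t = 1 * t] (mod p)"
      by (intro cong_mult fermat_theorem p False) simp
    moreover have "t ^ (p - 1) * t = t ^ p"
      using prime_gt_0_nat[OF p] by (simp add: power_eq_if)
    ultimately show ?thesis by (metis cong_int_iff of_nat_power nat_mult_1)
  qed
  then have "[i ^ p = i] (mod int p)"
    using t by (metis cong_pow cong_sym cong_trans)
  then show ?thesis by (simp add: cong_iff_dvd_diff)
qed

text \<open>The polynomial \<open>?F\<close> is X^p - f^(p-1) X. By Fermat, the \<open>p\<close>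
  distinct multiples of \<open>f\<close> by 0, ..., p-1 are roots of it; a root \<open>a\<close>
  that is no integer multiple of \<open>f\<close> would exceed the degree. In fractions: a / f is
  fixed by Frobenius, hence lies in the prime field.\<close>

lemma (in domain) mem_prime_field_multiples:
  assumes p: "Factorial_Ring.prime p" and zero: "\<And>i. \<guillemotleft>i\<guillemotright> = \<zero> \<longleftrightarrow> int p dvd i"
    and a: "a \<in> carrier R" and f: "f \<in> carrier R" "f \<noteq> \<zero>"
    and eq: "a [^] p = f [^] (p - 1) \<otimes> a"
  shows "\<exists>t. a = \<guillemotleft>t\<guillemotright> \<otimes> f"
proof (rule ccontr)
  assume neg: "\<not> ?thesis"
  obtain k where k: "p = k + 2" using prime_ge_2_nat[OF p] by (metis le_add_diff_inverse2)
  let ?b = "\<ominus> (f [^] (p - 1))"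
  let ?F = "\<one> # replicate k \<zero> @ [?b, \<zero>]"
  have F: "?F \<in> carrier (poly_ring R)"
    using f unfolding univ_poly_carrier[symmetric] polynomial_def by auto
  have root: "is_root ?F x" if "x \<in> carrier R" "x [^] p = f [^] (p - 1) \<otimes> x" for x
    unfolding is_root_def using eval_trinomial[of ?b \<zero> x k] that f k by (simp add: l_minus r_neg)
  have fermat: "\<guillemotleft>i\<guillemotright> [^] p = \<guillemotleft>i\<guillemotright>" for i
  proof -
    have "\<guillemotleft>i ^ p - i\<guillemotright> = \<zero>" using zero dvd_power_minus_self[OF p] by blast
    then show ?thesis by (simp only: of_int_diff of_int_power) (simp add: eq_diff0)
  qed
  let ?g = "\<lambda>t::nat. \<guillemotleft>int t\<guillemotright> \<otimes> f"
  have inj: "inj_on ?g {..<p}"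
  proof (rule inj_onI)
    fix s t assume st: "s \<in> {..<p}" "t \<in> {..<p}" "?g s = ?g t"
    then have "\<guillemotleft>int s\<guillemotright> = \<guillemotleft>int t\<guillemotright>" using f m_rcancel by simp
    then have "\<guillemotleft>int s - int t\<guillemotright> = \<zero>" by (simp add: r_neg minus_eq)
    then have "int p dvd int s - int t" using zero by blast
    then have "int s mod int p = int t mod int p" by (simp add: mod_eq_dvd_iff)
    then show "s = t" using st by simp
  qed
  have "is_root ?F (?g t)" for t
  proof (rule root)
    have "?g t [^] p = \<guillemotleft>int t\<guillemotright> \<otimes> f [^] p"
      using f fermat by (simp add: nat_pow_distrib)
    also have "f [^] p = f [^] (p - 1) \<otimes> f" using k f by simp
    finally show "?g t [^] p = f [^] (p - 1) \<otimes> ?g t" using f by (simp add: m_ac)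
  qed (use f in simp)
  then have "insert a (?g ` {..<p}) \<subseteq> {x. is_root ?F x}"
    using root[OF a eq] by auto
  then have "card (insert a (?g ` {..<p})) \<le> card {x. is_root ?F x}"
    by (intro card_mono finite_number_of_roots F)
  also have "\<dots> \<le> degree ?F" by (rule card_roots_le_degree[OF F]) simp
  also have "\<dots> = p" using k by simp
  finally have "card (insert a (?g ` {..<p})) \<le> p" .
  moreover have "a \<notin> ?g ` {..<p}" using neg by blast
  ultimately show False using card_image[OF inj] by simp
qed

text \<open>The polynomial X^p - X - h has derivative -1 because its leading coefficient contributes
  p = 0. It is therefore separable, with the cofactors 0 and -1 in the Bezout identity.\<close>

lemma (in field) separably_closed_artin_schreier:
  assumes sc: "separably_closed R" and p: "Factorial_Ring.prime p" and p0: "\<guillemotleft>int p\<guillemotright> = \<zero>"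
    and h: "h \<in> carrier R"
  shows "\<exists>x\<in>carrier R. x [^] p \<ominus> x = h"
proof -
  obtain k where k: "p = k + 2" using prime_ge_2_nat[OF p] by (metis le_add_diff_inverse2)
  let ?F = "\<one> # replicate k \<zero> @ [\<ominus> \<one>, \<ominus> h]"
  have m1: "\<ominus> \<one> \<noteq> \<zero>" by simp
  have F: "polynomial\<^bsub>R\<^esub> (carrier R) ?F"
    using h unfolding polynomial_def by auto
  have map_eq: "map (\<lambda>j. add_pow R (length ?F - 1 - j) (?F ! j)) [0..<length ?F - 1]
     = replicate (Suc k) \<zero> @ [\<ominus> \<one>]" (is "?l = ?r")
  proof (rule nth_equalityI)
    show "length ?l = length ?r" by simp
    fix j assume "j < length ?l"
    then have j: "j < k + 2" by simp
    consider "j = 0" | "0 < j" "j \<le> k" | "j = Suc k" using j by linarith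
    then show "?l ! j = ?r ! j"
    proof cases
      case 1
      have "add_pow R (Suc (Suc k)) \<one> = \<zero>"
        using p0 k of_integer_add_pow[of p] by (simp only: add_2_eq_Suc')
      then show ?thesis using 1 by (auto simp: nth_append numeral_2_eq_2 simp del: add.nat_pow_Suc)
    next
      case 2
      then obtain i where "j = Suc i" by (cases j) auto
      then show ?thesis using 2 by (simp add: nth_append)
    next
      case 3
      then show ?thesis by (simp add: nth_append)
    qed
  qed
  have "poly_deriv R ?F = [\<ominus> \<one>]"
    unfolding poly_deriv_def map_eq normalize_replicate_zero using m1 by simp
  moreover have "poly_mult [\<ominus> \<one>] [\<ominus> \<one>] = [\<one>]"
    by (simp add: l_minus r_minus)
  ultimately have sep: "separable_poly R ?F"
    unfolding separable_poly_def using m1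
    by (intro exI[of _ "[]"] exI[of _ "[\<ominus> \<one>]"]) (simp add: polynomial_def)
  have "2 \<le> length ?F" by simp
  with sep obtain x where x: "x \<in> carrier R" "eval ?F x = \<zero>"
    using sc F unfolding separably_closed_def by blast
  have "x [^] (k + 2) \<oplus> (\<ominus> \<one> \<otimes> x \<oplus> \<ominus> h) = \<zero>"
    using eval_trinomial[of "\<ominus> \<one>" "\<ominus> h" x k] x h by simp
  moreover have "x [^] (k + 2) \<oplus> (\<ominus> \<one> \<otimes> x \<oplus> \<ominus> h) = (x [^] (k + 2) \<ominus> x) \<ominus> h"
    using x(1) h nat_pow_closed[OF x(1), of "k + 2"] by algebra
  ultimately have "(x [^] p \<ominus> x) \<ominus> h = \<zero>" using k by metis
  then have "x [^] p \<ominus> x = h" using x(1) h eq_diff0[of "x [^] p \<ominus> x" h] by simp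
  then show ?thesis using x(1) by blast
qed

lemma (in ring_hom_cring) hom_of_integer: "h \<guillemotleft>i\<guillemotright>\<^bsub>R\<^esub> = \<guillemotleft>i\<guillemotright>\<^bsub>S\<^esub>"
proof -
  have "h \<guillemotleft>n\<guillemotright>\<^sub>\<nat>\<^bsub>R\<^esub> = \<guillemotleft>n\<guillemotright>\<^sub>\<nat>\<^bsub>S\<^esub>" for n by (induction n) simp_all
  then show ?thesis by (simp add: of_integer_def)
qed

lemma (in ideal) carrier_quotD:
  assumes "x \<in> carrier (R Quot I)"
  shows "\<exists>r\<in>carrier R. x = I +> r"
  using assms by (auto simp: FactRing_simps)

lemma (in cring) of_integer_quot_eq_zero:
  assumes p: "Factorial_Ring.prime p" and ch: "has_char R p" and Q: "primeideal Q R"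
  shows "\<guillemotleft>i\<guillemotright>\<^bsub>R Quot Q\<^esub> = \<zero>\<^bsub>R Quot Q\<^esub> \<longleftrightarrow> int p dvd i"
proof -
  interpret Q: primeideal Q R by (rule Q)
  interpret h: ring_hom_cring R "R Quot Q" "(+>) Q" by (rule Q.rcos_ring_hom_cring)
  have "\<guillemotleft>i\<guillemotright>\<^bsub>R Quot Q\<^esub> = \<zero>\<^bsub>R Quot Q\<^esub> \<longleftrightarrow> Q +> \<guillemotleft>i\<guillemotright> = Q +> \<zero>"
    by (simp add: h.hom_of_integer)
  also have "\<dots> \<longleftrightarrow> \<guillemotleft>i\<guillemotright> \<in> Q"
    using quotient_eq_iff_same_a_r_cos[OF Q.ideal_axioms, of "\<guillemotleft>i\<guillemotright>" \<zero>] by simp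
  finally show ?thesis using of_integer_mem_primeideal[OF p ch Q] by simp
qed

text \<open>By additivity of Frobenius, consecutive differences of the iteration are p-th powers of
  each other, so they tend to zero in the \<open>m\<close>-adic topology. The limit solves the
  equation modulo every power of \<open>m\<close>.\<close>

lemma (in cring) artin_schreier_max_ideal:
  assumes N: "noetherian_ring R" and L: "local_ring R m" and C: "adic_complete R m"
    and p: "Factorial_Ring.prime p" and ch: "has_char R p" and h: "h \<in> m"
  shows "\<exists>r\<in>carrier R. r [^] p \<ominus> r = h"
proof -
  have "maximalideal m R" using L by (simp add: local_ring_def)
  then interpret m: maximalideal m R .
  have mi: "ideal m R" by (rule m.ideal_axioms)
  have hc: "h \<in> carrier R" using m.Icarr[OF h] .
  obtain k where k: "p = k + 2" using prime_ge_2_nat[OF p] by (metis le_add_diff_inverse2)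
  have pow_p: "x [^] p \<in> ideal_pow R m (Suc n)" if n: "x \<in> ideal_pow R m n" "x \<in> m" for x n
  proof -
    have xc: "x \<in> carrier R" using m.Icarr[OF n(2)] .
    have "x [^] k \<otimes> x \<in> m" using m.I_l_closed[OF n(2)] xc by simp
    then have "(x [^] k \<otimes> x) \<otimes> x \<in> ideal_prod R m (ideal_pow R m n)"
      using n(1) by (rule ideal_prod.prod)
    then show ?thesis using k by simp
  qed
  \<comment> \<open>Iterating s := s^p - h from 0 produces the partial sums of - (h + h^p + h^(p^2) + ...).\<close>
  define s where "s = rec_nat \<zero> (\<lambda>_ x. x [^] p \<ominus> h)"
  have s0: "s 0 = \<zero>" and sS: "\<And>n. s (Suc n) = s n [^] p \<ominus> h" by (simp_all add: s_def)
  have sc: "s n \<in> carrier R" for n by (induction n) (simp_all add: s0 sS hc)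
  \<comment> \<open>Membership in \<open>m\<close> is carried along because the zeroth power of
    \<open>m\<close> is the whole ring, and \<open>pow_p\<close> needs a factor from
    \<open>m\<close> to gain one power.\<close>
  have dm: "s (Suc n) \<ominus> s n \<in> m \<and> s (Suc n) \<ominus> s n \<in> ideal_pow R m n" for n
  proof (induction n)
    case 0
    have "s (Suc 0) \<ominus> s 0 = \<ominus> h" using hc k by (simp add: s0 sS minus_eq)
    then show ?case using h hc by simp
  next
    case (Suc n)
    let ?d = "s (Suc n) \<ominus> s n"
    have "s (Suc (Suc n)) \<ominus> s (Suc n) = s (Suc n) [^] p \<ominus> s n [^] p"
      unfolding sS[of "Suc n"] using sS[of n] hc sc[of n] sc[of "Suc n"] nat_pow_closed
      by (simp add: minus_eq minus_add a_ac r_neg1 r_neg2 r_neg)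
    also have "\<dots> = ?d [^] p" using frobenius_diff[OF p ch sc sc] by simp
    finally have eq: "s (Suc (Suc n)) \<ominus> s (Suc n) = ?d [^] p" .
    have "?d [^] p \<in> ideal_pow R m (Suc n)" using pow_p Suc by blast
    moreover from this have "?d [^] p \<in> m"
      using ideal_prod_inter[OF mi ideal_pow_ideal[OF mi], of n] by auto
    ultimately show ?case unfolding eq by blast
  qed
  obtain y where y: "y \<in> carrier R" "\<And>n. y \<ominus> s n \<in> ideal_pow R m n"
    using C sc dm unfolding adic_complete_def by blast
  have "(y [^] p \<ominus> y) \<ominus> h \<in> ideal_pow R m n" for n
  proof -
    interpret I: ideal "ideal_pow R m n" R by (rule ideal_pow_ideal[OF mi])
    have yp: "(y \<ominus> s n) [^] p \<in> ideal_pow R m n"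
    proof -
      have "(y \<ominus> s n) [^] (k + 1) \<otimes> (y \<ominus> s n) \<in> ideal_pow R m n"
        using y sc by (intro I.I_l_closed) auto
      then show ?thesis using k by simp
    qed
    have "s (Suc n) \<ominus> y = (s (Suc n) \<ominus> s n) \<ominus> (y \<ominus> s n)"
      using sc[of n] sc[of "Suc n"] y(1) by algebra
    also have "\<dots> \<in> ideal_pow R m n"
      using dm[of n] y(2)[of n] by (simp add: minus_eq)
    finally have "(y \<ominus> s n) [^] p \<oplus> (s (Suc n) \<ominus> y) \<in> ideal_pow R m n" using yp by blast
    moreover have "(y \<ominus> s n) [^] p \<oplus> (s (Suc n) \<ominus> y) = (y [^] p \<ominus> y) \<ominus> h"
      unfolding frobenius_diff[OF p ch y(1) sc] sS
      using y(1) sc[of n] hc nat_pow_closed[OF y(1), of p] nat_pow_closed[OF sc, of n p] by algebra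
    ultimately show ?thesis by simp
  qed
  \<comment> \<open>\<open>adic_complete\<close> provides a limit only; that congruences modulo all
    powers of \<open>m\<close> amount to equality is the Krull intersection theorem.\<close>
  then have "(y [^] p \<ominus> y) \<ominus> h = \<zero>" by (rule krull_intersection[OF N L])
  then show ?thesis using y(1) hc eq_diff0 by auto
qed

text \<open>The map r \<mapsto> r^p - r is additive, so the equation is solved in two steps: in the
  residue field by separable closedness, and then for the remaining error in \<open>m\<close> by
  completeness.\<close>

lemma (in cring) artin_schreier:
  assumes N: "noetherian_ring R" and L: "local_ring R m" and C: "adic_complete R m"
    and p: "Factorial_Ring.prime p" and ch: "has_char R p"
    and sc: "separably_closed (R Quot m)" and h: "h \<in> carrier R"
  shows "\<exists>r\<in>carrier R. r [^] p \<ominus> r = h"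
proof -
  have m: "maximalideal m R" using L by (simp add: local_ring_def)
  then interpret m: maximalideal m R .
  interpret h: ring_hom_cring R "R Quot m" "(+>) m" by (rule m.rcos_ring_hom_cring[OF is_cring])
  interpret K: field "R Quot m" using sc by (simp add: separably_closed_def)
  have "\<guillemotleft>int p\<guillemotright>\<^bsub>R Quot m\<^esub> = \<zero>\<^bsub>R Quot m\<^esub>"
    by (simp add: of_integer_quot_eq_zero[OF p ch maximalideal_prime[OF m]])
  from K.separably_closed_artin_schreier[OF sc p this h.hom_closed[OF h]]
  obtain x where x: "x \<in> carrier (R Quot m)" "x [^]\<^bsub>R Quot m\<^esub> p \<ominus>\<^bsub>R Quot m\<^esub> x = m +> h" by blast
  obtain r where r: "r \<in> carrier R" "x = m +> r" using m.carrier_quotD[OF x(1)] by blast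
  have "m +> (r [^] p \<ominus> r) = m +> h"
    using x(2) r by (simp add: a_minus_def)
  then have "(r [^] p \<ominus> r) \<ominus> h \<in> m"
    using quotient_eq_iff_same_a_r_cos[OF m.ideal_axioms] r(1) h by simp
  then have "h \<ominus> (r [^] p \<ominus> r) \<in> m"
    using m.a_inv_closed[of "(r [^] p \<ominus> r) \<ominus> h"] r(1) h by (simp add: minus_eq minus_add a_ac)
  from artin_schreier_max_ideal[OF N L C p ch this]
  obtain s where s: "s \<in> carrier R" "s [^] p \<ominus> s = h \<ominus> (r [^] p \<ominus> r)" by blast
  have "(r \<oplus> s) [^] p \<ominus> (r \<oplus> s) = (r [^] p \<ominus> r) \<oplus> (s [^] p \<ominus> s)"
    unfolding frobenius_add[OF p ch r(1) s(1)]
    using r(1) s(1) nat_pow_closed[OF r(1), of p] nat_pow_closed[OF s(1), of p] by algebra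
  also have "\<dots> = h" unfolding s(2) using r(1) h nat_pow_closed[OF r(1), of p] by algebra
  finally show ?thesis using r(1) s(1) by blast
qed

section \<open>Consequences of depth at least three\<close>

lemma (in cring) mem_genideal_pair:
  assumes "x \<in> carrier R" "y \<in> carrier R"
  shows "v \<in> Idl {x, y} \<longleftrightarrow> (\<exists>i\<in>PIdl x. \<exists>r\<in>carrier R. v = i \<oplus> y \<otimes> r)"
proof -
  have "Idl {x, y} = PIdl x <+> PIdl y"
  proof
    have "x \<in> PIdl x <+> PIdl y" "y \<in> PIdl x <+> PIdl y" "ideal (PIdl x <+> PIdl y) R"
      using ideal_add_cgenideal[OF cgenideal_ideal[OF assms(1)] assms(2)] cgenideal_self[OF assms(1)] by auto
    then show "Idl {x, y} \<subseteq> PIdl x <+> PIdl y" by (intro genideal_minimal) auto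
    interpret I: ideal "Idl {x, y}" R using assms by (intro genideal_ideal) auto
    have "x \<in> Idl {x, y}" "y \<in> Idl {x, y}" using genideal_self[of "{x, y}"] assms by auto
    then have "PIdl x \<subseteq> Idl {x, y}" "y \<in> Idl {x, y}"
      using cgenideal_minimal[OF I.ideal_axioms] by auto
    then show "PIdl x <+> PIdl y \<subseteq> Idl {x, y}"
      unfolding subset_iff mem_add_cgenideal[OF assms(2)] by (auto intro!: I.a_closed I.I_l_closed)
  qed
  then show ?thesis using mem_add_cgenideal[OF assms(2), of v "PIdl x"] m_comm[OF assms(2)] by auto
qed

lemma (in cring) depth_ge_3E:
  assumes "depth_ge R m 3"
  obtains x y z where "x \<in> m" "y \<in> m" "z \<in> m" "x \<in> carrier R" "y \<in> carrier R" "z \<in> carrier R"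
    and "\<And>v. v \<in> carrier R \<Longrightarrow> x \<otimes> v = \<zero> \<Longrightarrow> v = \<zero>"
    and "\<And>v. v \<in> carrier R \<Longrightarrow> y \<otimes> v \<in> PIdl x \<Longrightarrow> v \<in> PIdl x"
    and "\<And>v. v \<in> carrier R \<Longrightarrow> z \<otimes> v \<in> Idl {x, y} \<Longrightarrow> v \<in> Idl {x, y}"
proof -
  obtain xs where xs: "length xs = 3" "set xs \<subseteq> m" "regular_sequence R xs"
    using assms unfolding depth_ge_def by blast
  then obtain x y z where xyz: "xs = [x, y, z]"
    by (auto simp: numeral_3_eq_3 length_Suc_conv)
  have c: "x \<in> carrier R" "y \<in> carrier R" "z \<in> carrier R"
    using xs(3) unfolding xyz regular_sequence_def by auto
  have r: "v \<in> Idl (set (take i xs))" if "i < 3" "v \<in> carrier R" "xs ! i \<otimes> v \<in> Idl (set (take i xs))" for i v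
    using xs(1,3) that unfolding regular_sequence_def by simp
  have "Idl {} = {\<zero>}"
    using genideal_minimal[OF zeroideal, of "{}"] ideal.axioms(1)[OF genideal_ideal[of "{}"]]
      additive_subgroup.zero_closed by blast
  then have r0: "x \<otimes> v = \<zero> \<Longrightarrow> v = \<zero>" if "v \<in> carrier R" for v
    using r[of 0 v] that xyz by simp
  have r1: "y \<otimes> v \<in> PIdl x \<Longrightarrow> v \<in> PIdl x" if "v \<in> carrier R" for v
    using r[of 1 v] that xyz cgenideal_eq_genideal[OF c(1)] by simp
  have r2: "z \<otimes> v \<in> Idl {x, y} \<Longrightarrow> v \<in> Idl {x, y}" if "v \<in> carrier R" for v
    using r[of 2 v] that xyz by (simp add: numeral_2_eq_2)
  have "x \<in> m" "y \<in> m" "z \<in> m" using xs(2) xyz by auto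
  from that[OF this c r0 r1 r2] show ?thesis .
qed

text \<open>This is the extension of sections from the punctured spectrum: the fractions a f /
  \<phi> f agree on overlaps, and \<open>h\<close> is their common extension. It is Koszul degree
  one over the zero ideal, cancelling \<open>x\<close>, with degree zero modulo \<open>x\<close>,
  cancelling \<open>y\<close>.\<close>

lemma (in cring) depth_ge_3_gluing:
  assumes depth: "depth_ge R m 3" and T: "\<phi> ` T \<subseteq> carrier R"
    and mT: "\<And>x. x \<in> m \<Longrightarrow> \<exists>N::nat. x [^] N \<in> Idl (\<phi> ` T)"
    and a: "\<And>f. f \<in> T \<Longrightarrow> a f \<in> carrier R"
      "\<And>f g. f \<in> T \<Longrightarrow> g \<in> T \<Longrightarrow> \<phi> g \<otimes> a f = \<phi> f \<otimes> a g"
  shows "\<exists>h\<in>carrier R. \<forall>f\<in>T. a f = \<phi> f \<otimes> h"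
proof -
  from depth_ge_3E[OF depth] obtain x y where
    xy: "x \<in> m" "y \<in> m" "x \<in> carrier R" "y \<in> carrier R"
    and x: "\<And>v. v \<in> carrier R \<Longrightarrow> x \<otimes> v = \<zero> \<Longrightarrow> v = \<zero>"
    and y: "\<And>v. v \<in> carrier R \<Longrightarrow> y \<otimes> v \<in> PIdl x \<Longrightarrow> v \<in> PIdl x" by metis
  obtain N N' :: nat where N: "x [^] N \<in> Idl (\<phi> ` T)" "y [^] N' \<in> Idl (\<phi> ` T)"
    using mT xy by blast
  interpret I: ideal "PIdl x" R by (rule cgenideal_ideal[OF xy(3)])
  have "\<exists>h\<in>carrier R. \<forall>f\<in>T. a f \<ominus> \<phi> f \<otimes> h \<in> {\<zero>}"
  proof (rule koszul_vanishing1[OF zeroideal, where J = "PIdl x"])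
    show "u \<in> PIdl x" if "u \<in> carrier R" "\<And>f. f \<in> T \<Longrightarrow> \<phi> f \<otimes> u \<in> PIdl x" for u
      using koszul_vanishing0[OF I.ideal_axioms T xy(4) y N(2) that(1)] that(2) by blast
    show "\<exists>i\<in>{\<zero>}. \<exists>r\<in>carrier R. v = i \<oplus> x \<otimes> r" if v: "v \<in> PIdl x" for v
    proof -
      obtain r where r: "r \<in> carrier R" "v = r \<otimes> x" using v unfolding cgenideal_def by blast
      then have "v = \<zero> \<oplus> x \<otimes> r" using xy(3) m_comm[OF r(1) xy(3)] by simp
      then show ?thesis using r(1) by blast
    qed
    show "i \<oplus> x \<otimes> r \<in> PIdl x" if "i \<in> {\<zero>}" "r \<in> carrier R" for i r
      using that xy(3) I.I_r_closed[OF cgenideal_self[OF xy(3)]] by simp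
    show "\<phi> g \<otimes> a f \<ominus> \<phi> f \<otimes> a g \<in> {\<zero>}" if "f \<in> T" "g \<in> T" for f g
    proof -
      have "\<phi> g \<otimes> a f \<in> carrier R" "\<phi> f \<otimes> a g \<in> carrier R" using a(1) that T by blast+
      then show ?thesis using a(2)[OF that] eq_diff0 by blast
    qed
    show "v \<in> {\<zero>}" if "v \<in> carrier R" "x \<otimes> v \<in> {\<zero>}" for v using x that by blast
  qed (use N T xy(3) a(1) in blast)+
  then show ?thesis using a(1) T eq_diff0 by (auto simp: image_subset_iff)
qed

text \<open>With u f g / (f g) as a Cech cocycle, this is the vanishing of the first cohomology of
  the structure sheaf. Degree two cancels \<open>x\<close>, degree one modulo \<open>x\<close>
  cancels \<open>y\<close>, and degree zero modulo \<open>Idl {x, y}\<close> cancels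
  \<open>z\<close>.\<close>

lemma (in cring) depth_ge_3_cocycle:
  assumes depth: "depth_ge R m 3" and T: "T \<subseteq> carrier R"
    and mT: "\<And>x. x \<in> m \<Longrightarrow> \<exists>N::nat. x [^] N \<in> Idl T"
    and u: "\<And>f g. f \<in> T \<Longrightarrow> g \<in> T \<Longrightarrow> u f g \<in> carrier R"
      "\<And>f g k. f \<in> T \<Longrightarrow> g \<in> T \<Longrightarrow> k \<in> T \<Longrightarrow> k \<otimes> u f g = g \<otimes> u f k \<ominus> f \<otimes> u g k"
  shows "\<exists>a. (\<forall>f\<in>T. a f \<in> carrier R) \<and> (\<forall>f\<in>T. \<forall>g\<in>T. u f g = g \<otimes> a f \<ominus> f \<otimes> a g)"
proof -
  from depth_ge_3E[OF depth] obtain x y z where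
    xyz: "x \<in> m" "y \<in> m" "z \<in> m" "x \<in> carrier R" "y \<in> carrier R" "z \<in> carrier R"
    and x: "\<And>v. v \<in> carrier R \<Longrightarrow> x \<otimes> v = \<zero> \<Longrightarrow> v = \<zero>"
    and y: "\<And>v. v \<in> carrier R \<Longrightarrow> y \<otimes> v \<in> PIdl x \<Longrightarrow> v \<in> PIdl x"
    and z: "\<And>v. v \<in> carrier R \<Longrightarrow> z \<otimes> v \<in> Idl {x, y} \<Longrightarrow> v \<in> Idl {x, y}" by metis
  obtain N N' N'' :: nat where N: "x [^] N \<in> Idl T" "y [^] N' \<in> Idl T" "z [^] N'' \<in> Idl T"
    using mT xyz by metis
  interpret I: ideal "PIdl x" R by (rule cgenideal_ideal[OF xyz(4)])
  interpret J: ideal "Idl {x, y}" R using xyz by (intro genideal_ideal) auto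
  have Ty: "(\<lambda>f. f) ` T \<subseteq> carrier R" "y [^] N' \<in> Idl ((\<lambda>f. f) ` T)" using T N(2) by auto
  show ?thesis
  proof (rule koszul_vanishing2[OF T xyz(4) x N(1) _ u])
    fix a assume a: "\<And>f. f \<in> T \<Longrightarrow> a f \<in> carrier R"
      "\<And>f g. f \<in> T \<Longrightarrow> g \<in> T \<Longrightarrow> g \<otimes> a f \<ominus> f \<otimes> a g \<in> PIdl x"
    show "\<exists>h\<in>carrier R. \<forall>f\<in>T. a f \<ominus> f \<otimes> h \<in> PIdl x"
    proof (rule koszul_vanishing1[OF I.ideal_axioms, where J = "Idl {x, y}", OF Ty(1) xyz(5) y Ty(2)])
      show "u \<in> Idl {x, y}" if "u \<in> carrier R" "\<And>f. f \<in> T \<Longrightarrow> f \<otimes> u \<in> Idl {x, y}" for u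
        by (rule koszul_vanishing0[OF J.ideal_axioms T xyz(6) z N(3) that])
    qed (use a mem_genideal_pair[OF xyz(4,5)] in blast)+
  qed
qed

text \<open>In the domain \<open>R Quot Q\<close> the fraction a / f is a Frobenius-fixed element
  with nonzero denominator, so it is the image of an integer. This reads off the locally constant
  value of a section at the point \<open>Q\<close>.\<close>

lemma (in cring) prime_field_residue:
  assumes p: "Factorial_Ring.prime p" and ch: "has_char R p" and Q: "primeideal Q R"
    and a: "a \<in> carrier R" and f: "f \<in> carrier R" "f \<notin> Q"
    and eq: "a [^] p = f [^] (p - 1) \<otimes> a"
  shows "\<exists>t. a \<ominus> \<guillemotleft>t\<guillemotright> \<otimes> f \<in> Q"
proof -
  interpret Q: primeideal Q R by (rule Q)
  interpret h: ring_hom_cring R "R Quot Q" "(+>) Q" by (rule Q.rcos_ring_hom_cring)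
  interpret D: domain "R Quot Q" by (rule Q.quotient_is_domain)
  have iff: "Q +> b = Q +> c \<longleftrightarrow> b \<ominus> c \<in> Q" if "b \<in> carrier R" "c \<in> carrier R" for b c
    using quotient_eq_iff_same_a_r_cos[OF Q.ideal_axioms that] by simp
  have "Q +> f \<noteq> \<zero>\<^bsub>R Quot Q\<^esub>" using iff[of f \<zero>] f by (metis h.hom_zero minus_0_r zero_closed)
  moreover have "(Q +> a) [^]\<^bsub>R Quot Q\<^esub> p = (Q +> f) [^]\<^bsub>R Quot Q\<^esub> (p - 1) \<otimes>\<^bsub>R Quot Q\<^esub> (Q +> a)"
    using arg_cong[OF eq, of "(+>) Q"] a f by simp
  ultimately obtain t where "Q +> a = \<guillemotleft>t\<guillemotright>\<^bsub>R Quot Q\<^esub> \<otimes>\<^bsub>R Quot Q\<^esub> (Q +> f)"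
    using D.mem_prime_field_multiples[OF p of_integer_quot_eq_zero[OF p ch Q]] a f by blast
  then have "Q +> a = Q +> (\<guillemotleft>t\<guillemotright> \<otimes> f)" using f by (simp add: h.hom_of_integer)
  then show ?thesis using iff[OF a m_closed[OF of_int_closed f(1)]] by blast
qed

lemma (in cring) of_integer_fermat:
  assumes p: "Factorial_Ring.prime p" and ch: "has_char R p"
  shows "\<guillemotleft>i\<guillemotright> [^] p = \<guillemotleft>i\<guillemotright>"
proof -
  have "\<guillemotleft>i ^ p - i\<guillemotright> = \<zero>" using ch dvd_power_minus_self[OF p] by (rule of_integer_char)
  then show ?thesis by (simp only: of_int_diff of_int_power) (simp add: eq_diff0)
qed

section \<open>The punctured spectrum\<close>

lemma (in cring) primeideal_carrier: "primeideal Q R \<Longrightarrow> Q \<subseteq> carrier R"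
  by (rule subsetI) (rule ideal.Icarr[OF primeideal.axioms(1)])

lemma (in cring) primeideal_one: "primeideal Q R \<Longrightarrow> \<one> \<notin> Q"
  using ideal.one_imp_carrier[OF primeideal.axioms(1)] primeideal.I_notcarr by blast

lemma (in cring) primeideal_pow:
  assumes "primeideal Q R" "x \<in> carrier R" "x [^] (k::nat) \<in> Q"
  shows "x \<in> Q"
  using assms(3)
proof (induction k)
  case 0
  then show ?case using primeideal_one[OF assms(1)] by simp
next
  case (Suc k)
  then show ?case using primeideal.I_prime[OF assms(1), of "x [^] k" x] assms(2) by auto
qed

lemma (in cring) primeideal_mult:
  assumes "primeideal Q R" "x \<in> carrier R" "y \<in> carrier R"
  shows "x \<otimes> y \<in> Q \<longleftrightarrow> x \<in> Q \<or> y \<in> Q"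
  using primeideal.I_prime[OF assms(1,2,3)] ideal.I_l_closed[OF primeideal.axioms(1)[OF assms(1)], of y x]
    ideal.I_r_closed[OF primeideal.axioms(1)[OF assms(1)], of x y] assms(2,3) by blast

locale complete_local_depth3 = cring R for R (structure) +
  fixes m :: "'a set" and p n :: nat and P :: "nat \<Rightarrow> 'a set"
  assumes noeth: "noetherian_ring R" and local: "local_ring R m" and complete: "adic_complete R m"
    and prime_p: "Factorial_Ring.prime p" and char_p: "has_char R p"
    and sep_closed: "separably_closed (R Quot m)"
    and depth: "depth_ge R m 3"
    and bij: "bij_betw P {1..n} {Q. minimal_prime R Q}"
begin

abbreviation "D \<equiv> Delta R m n P"

text \<open>The irreducible components of the spectrum, given by their indices, that meet the basic
  open set of \<open>f\<close>.\<close>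

definition supp :: "'a \<Rightarrow> nat set" where
  "supp f = {l \<in> {1..n}. f \<notin> P l}"

lemma finite_supp: "finite (supp f)" by (simp add: supp_def)

lemma max_m: "maximalideal m R" using local by (simp add: local_ring_def)

lemma prime_m: "primeideal m R" by (rule maximalideal_prime[OF max_m])

lemma minimal_P: "l \<in> {1..n} \<Longrightarrow> minimal_prime R (P l)"
  using bij_betw_apply[OF bij] by blast

lemma prime_P: "l \<in> {1..n} \<Longrightarrow> primeideal (P l) R"
  using minimal_P by (simp add: minimal_prime_def)

lemma P_below: "primeideal Q R \<Longrightarrow> \<exists>l\<in>{1..n}. P l \<subseteq> Q"
proof -
  assume "primeideal Q R"
  then obtain Q0 where Q0: "minimal_prime R Q0" "Q0 \<subseteq> Q" using exists_minimal_prime_below by blast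
  then have "Q0 \<in> P ` {1..n}" using bij by (simp add: bij_betw_def)
  then show ?thesis using Q0(2) by blast
qed

lemma primeideal_le_m:
  assumes Q: "primeideal Q R" shows "Q \<subseteq> m"
proof
  fix x assume x: "x \<in> Q"
  then have xc: "x \<in> carrier R" using primeideal_carrier[OF Q] by blast
  show "x \<in> m"
  proof (rule ccontr)
    assume "x \<notin> m"
    then obtain y where "y \<in> carrier R" "x \<otimes> y = \<one>" using local_ring_unit[OF noeth local xc] by blast
    then show False using ideal.I_r_closed[OF primeideal.axioms(1)[OF Q] x] primeideal_one[OF Q] by metis
  qed
qed

text \<open>Geometrically, the components indexed by a face meet at a point of the punctured
  spectrum. If the radical is smaller than \<open>m\<close>, some \<open>x \<in> m\<close> has no
  power in the sum of the primes, and a prime above this sum avoiding \<open>x\<close> is such a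
  point.\<close>

lemma face_iff:
  "F \<in> D \<longleftrightarrow> F \<subseteq> {1..n} \<and> F \<noteq> {} \<and> (\<exists>Q. primeideal Q R \<and> Q \<noteq> m \<and> (\<forall>l\<in>F. P l \<subseteq> Q))"
proof -
  have "rad R (Idl (\<Union>i\<in>F. P i)) \<noteq> m \<longleftrightarrow> (\<exists>Q. primeideal Q R \<and> Q \<noteq> m \<and> (\<forall>l\<in>F. P l \<subseteq> Q))"
    if F: "F \<subseteq> {1..n}"
  proof -
    let ?I = "Idl (\<Union>i\<in>F. P i)"
    have c: "(\<Union>i\<in>F. P i) \<subseteq> carrier R" using F prime_P primeideal_carrier by blast
    have I: "ideal ?I R" by (rule genideal_ideal[OF c])
    have "(\<Union>i\<in>F. P i) \<subseteq> m" using F prime_P primeideal_le_m by blast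
    then have Im: "?I \<subseteq> m" by (intro genideal_minimal primeideal.axioms(1)[OF prime_m])
    have radm: "rad R ?I \<subseteq> m"
      using primeideal_pow[OF prime_m] Im unfolding rad_def by blast
    show ?thesis
    proof
      assume "rad R ?I \<noteq> m"
      then obtain x where x: "x \<in> m" "x \<notin> rad R ?I" using radm by blast
      then have xc: "x \<in> carrier R" using primeideal_carrier[OF prime_m] by blast
      have "\<And>k::nat. x [^] k \<notin> ?I" using x(2) xc unfolding rad_def by blast
      then obtain Q where Q: "primeideal Q R" "?I \<subseteq> Q" "x \<notin> Q"
        using noetherian_prime_avoiding[OF noeth I xc] by blast
      then have "\<forall>l\<in>F. P l \<subseteq> Q" using genideal_self[OF c] by blast
      then show "\<exists>Q. primeideal Q R \<and> Q \<noteq> m \<and> (\<forall>l\<in>F. P l \<subseteq> Q)" using Q x(1) by blast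
    next
      assume "\<exists>Q. primeideal Q R \<and> Q \<noteq> m \<and> (\<forall>l\<in>F. P l \<subseteq> Q)"
      then obtain Q where Q: "primeideal Q R" "Q \<noteq> m" "\<forall>l\<in>F. P l \<subseteq> Q" by blast
      then have "?I \<subseteq> Q" by (intro genideal_minimal primeideal.axioms(1)) auto
      then have "rad R ?I \<subseteq> Q" using primeideal_pow[OF Q(1)] unfolding rad_def by blast
      then show "rad R ?I \<noteq> m" using primeideal_le_m[OF Q(1)] Q(2) by blast
    qed
  qed
  then show ?thesis unfolding Delta_def by blast
qed

lemma face_subset: "F \<in> D \<Longrightarrow> G \<subseteq> F \<Longrightarrow> G \<noteq> {} \<Longrightarrow> G \<in> D"
  unfolding face_iff by blast

text \<open>An element of all minimal primes lies in every prime and is nilpotent; the ideal of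
  these elements is nilpotent by noetherianity, which gives one exponent for all of them.\<close>

lemma nilpotent_bound:
  "\<exists>M>0. \<forall>x\<in>carrier R. supp x = {} \<longrightarrow> x [^] (M::nat) = \<zero>"
proof -
  define N where "N = {x \<in> carrier R. \<forall>l\<in>{1..n}. x \<in> P l}"
  have idP: "ideal (P l) R" if "l \<in> {1..n}" for l using prime_P[OF that] by (rule primeideal.axioms(1))
  have N: "ideal N R"
    unfolding N_def
    by (rule cring_idealI) (auto simp del: atLeastAtMost_iff
        intro: additive_subgroup.zero_closed[OF ideal.axioms(1)[OF idP]]
          additive_subgroup.a_closed[OF ideal.axioms(1)[OF idP]] ideal.I_l_closed[OF idP])
  have "\<exists>k::nat. x [^] k \<in> {\<zero>}" if x: "x \<in> N" for x
  proof (rule ccontr)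
    assume "\<not> ?thesis"
    moreover have xc: "x \<in> carrier R" using x by (simp add: N_def)
    ultimately obtain Q where Q: "primeideal Q R" "x \<notin> Q"
      using noetherian_prime_avoiding[OF noeth zeroideal, of x] by blast
    then show False using P_below[OF Q(1)] x by (auto simp: N_def)
  qed
  then obtain k where k: "ideal_pow R N k \<subseteq> {\<zero>}"
    using noetherian_ideal_pow_subset[OF noeth N zeroideal] by blast
  \<comment> \<open>The successor makes the exponent positive, so that raising to it leaves
    \<open>supp\<close> unchanged.\<close>
  have "x [^] Suc k = \<zero>" if x: "x \<in> carrier R" "supp x = {}" for x
  proof -
    have "x \<in> N" using x by (auto simp: N_def supp_def)
    then have "x [^] k = \<zero>" using ideal_pow_mem[OF N] k by blast
    then show ?thesis using x(1) by simp
  qed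
  then show ?thesis by blast
qed

definition nil_exp :: nat where
  "nil_exp = (SOME M. M > 0 \<and> (\<forall>x\<in>carrier R. supp x = {} \<longrightarrow> x [^] M = \<zero>))"

lemma nil_exp: "nil_exp > 0" "\<And>x. x \<in> carrier R \<Longrightarrow> supp x = {} \<Longrightarrow> x [^] nil_exp = \<zero>"
  using someI_ex[OF nilpotent_bound] unfolding nil_exp_def by blast+

text \<open>The basic open sets \<open>D(g)\<close> with \<open>g \<in> charts\<close> cover the punctured spectrum, and each of them
  meets only components forming a face. Taking powers makes products of charts with empty
  intersection vanish instead of merely being nilpotent.\<close>

definition charts :: "'a set" where
  "charts = (\<lambda>f. f [^] nil_exp) ` {f \<in> m. supp f \<in> D}"

lemma supp_mult:
  "x \<in> carrier R \<Longrightarrow> y \<in> carrier R \<Longrightarrow> supp (x \<otimes> y) = supp x \<inter> supp y"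
  unfolding supp_def using primeideal_mult[OF prime_P] by auto

lemma supp_pow: "x \<in> carrier R \<Longrightarrow> k > 0 \<Longrightarrow> supp (x [^] (k::nat)) = supp x"
proof (induction k)
  case (Suc k)
  then show ?case by (cases "k = 0") (simp_all add: supp_mult)
qed simp

lemma m_carrier: "x \<in> m \<Longrightarrow> x \<in> carrier R"
  using primeideal_carrier[OF prime_m] by blast

lemma charts_carrier: "g \<in> charts \<Longrightarrow> g \<in> carrier R"
  unfolding charts_def using m_carrier by auto

lemma charts_face: "g \<in> charts \<Longrightarrow> supp g \<in> D"
  unfolding charts_def using supp_pow[OF _ nil_exp(1)] m_carrier by auto

lemma chart_prod_zero:
  assumes "f \<in> charts" "g \<in> charts" "supp f \<inter> supp g = {}"
  shows "f \<otimes> g = \<zero>"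
proof -
  obtain x y where xy: "x \<in> m" "y \<in> m" "f = x [^] nil_exp" "g = y [^] nil_exp"
    using assms(1,2) unfolding charts_def by blast
  note c = xy(1,2)[THEN m_carrier]
  have "supp (x \<otimes> y) = {}"
    using assms(3) xy(3,4) c supp_pow[OF _ nil_exp(1)] by (simp add: supp_mult)
  then have "(x \<otimes> y) [^] nil_exp = \<zero>" using nil_exp(2) c by simp
  then show ?thesis using xy c by (simp add: nat_pow_distrib)
qed

lemma chart_prod3_zero:
  assumes "f \<in> charts" "g \<in> charts" "k \<in> charts" "supp f \<inter> supp g \<inter> supp k = {}"
  shows "f \<otimes> g \<otimes> k = \<zero>"
proof -
  obtain x y z where xy: "x \<in> m" "y \<in> m" "z \<in> m" "f = x [^] nil_exp" "g = y [^] nil_exp" "k = z [^] nil_exp"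
    using assms(1-3) unfolding charts_def by blast
  note c = xy(1-3)[THEN m_carrier]
  have "supp (x \<otimes> y \<otimes> z) = {}"
    using assms(4) xy c supp_pow[OF _ nil_exp(1)] by (simp add: supp_mult)
  then have "(x \<otimes> y \<otimes> z) [^] nil_exp = \<zero>" using nil_exp(2) c by simp
  then show ?thesis using xy c by (simp add: nat_pow_distrib)
qed

text \<open>Start with an element of \<open>m\<close> outside \<open>Q\<close> and multiply it by
  one element of \<open>P l\<close> outside \<open>Q\<close> for each component \<open>P l\<close>
  not passing through \<open>Q\<close>. The product stays in \<open>m\<close> and outside
  \<open>Q\<close>, and its support consists only of components through \<open>Q\<close>, so
  \<open>Q\<close> witnesses that the support is a face.\<close>

lemma chart_exists:
  assumes Q: "primeideal Q R" "Q \<noteq> m"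
  shows "\<exists>g\<in>charts. g \<notin> Q"
proof -
  define A where "A = {l \<in> {1..n}. \<not> P l \<subseteq> Q}"
  have "\<exists>f\<in>m. f \<notin> Q \<and> (\<forall>l\<in>B. f \<in> P l)" if "finite B" "B \<subseteq> A" for B
    using that
  proof (induction B)
    case empty
    have "\<not> m \<subseteq> Q" using primeideal_le_m[OF Q(1)] Q(2) by blast
    then show ?case by blast
  next
    case (insert l B)
    then obtain f where f: "f \<in> m" "f \<notin> Q" "\<forall>l\<in>B. f \<in> P l" by auto
    have l: "l \<in> {1..n}" "\<not> P l \<subseteq> Q" using insert.prems by (auto simp: A_def)
    then obtain x where x: "x \<in> P l" "x \<notin> Q" by blast
    have c: "f \<in> carrier R" "x \<in> carrier R"
      using f(1) m_carrier x(1) primeideal_carrier[OF prime_P[OF l(1)]] by blast+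
    have "f \<otimes> x \<in> m" using primeideal_mult[OF prime_m c] f(1) by blast
    moreover have "f \<otimes> x \<notin> Q" using primeideal_mult[OF Q(1) c] f(2) x(2) by blast
    moreover have "f \<otimes> x \<in> P l'" if "l' \<in> insert l B" for l'
    proof -
      have "l' \<in> {1..n}" using that insert.prems by (auto simp: A_def)
      then show ?thesis using primeideal_mult[OF prime_P c] that f(3) x(1) by blast
    qed
    ultimately show ?case by blast
  qed
  moreover have "finite A" by (simp add: A_def)
  ultimately obtain f where f: "f \<in> m" "f \<notin> Q" "\<forall>l\<in>A. f \<in> P l" by blast
  obtain l where l: "l \<in> {1..n}" "P l \<subseteq> Q" using P_below[OF Q(1)] by blast
  have "supp f \<subseteq> {l \<in> {1..n}. P l \<subseteq> Q}" using f(3) by (auto simp: supp_def A_def)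
  moreover have "l \<in> supp f" using l f(2) by (auto simp: supp_def)
  ultimately have "supp f \<in> D" unfolding face_iff using Q by blast
  then have "f [^] nil_exp \<in> charts" using f(1) unfolding charts_def by blast
  moreover have "f [^] nil_exp \<notin> Q" using primeideal_pow[OF Q(1)] f(1,2) m_carrier by blast
  ultimately show ?thesis by blast
qed

text \<open>A prime containing all k-th powers of charts would contain all charts, hence be
  \<open>m\<close>, by \<open>chart_exists\<close>. A general exponent is allowed because p-th
  powers of charts become the denominators once Frobenius has been applied.\<close>

lemma charts_radical:
  assumes x: "x \<in> m" and k: "k > 0"
  shows "\<exists>N::nat. x [^] N \<in> Idl ((\<lambda>f. f [^] (k::nat)) ` charts)"
proof (rule ccontr)
  let ?T = "(\<lambda>f. f [^] k) ` charts"
  assume "\<not> ?thesis"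
  moreover have T: "?T \<subseteq> carrier R" using charts_carrier by auto
  ultimately obtain Q where Q: "primeideal Q R" "Idl ?T \<subseteq> Q" "x \<notin> Q"
    using noetherian_prime_avoiding[OF noeth genideal_ideal[OF T] m_carrier[OF x]] by blast
  then obtain g where g: "g \<in> charts" "g \<notin> Q" using chart_exists[OF Q(1)] x by blast
  then have "g [^] k \<in> Q" using genideal_self[OF T] Q(2) by blast
  then show False using primeideal_pow[OF Q(1) charts_carrier[OF g(1)]] g(2) by blast
qed

section \<open>From simplicial cochains modulo p to sections over charts and back\<close>

lemma of_integer_mem: "primeideal Q R \<Longrightarrow> \<guillemotleft>i\<guillemotright> \<in> Q \<longleftrightarrow> int p dvd i"
  by (rule of_integer_mem_primeideal[OF prime_p char_p])

text \<open>A chart around a point \<open>Q\<close> common to the components of \<open>F\<close>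
  meets all of them. The point is kept in the conclusion because values of a section on different
  components are compared there.\<close>

lemma face_chart:
  assumes "F \<in> D"
  shows "\<exists>Q g. primeideal Q R \<and> g \<in> charts \<and> g \<notin> Q \<and> F \<subseteq> supp g \<and> (\<forall>l\<in>F. P l \<subseteq> Q)"
proof -
  obtain Q where Q: "primeideal Q R" "Q \<noteq> m" "F \<subseteq> {1..n}" "\<forall>l\<in>F. P l \<subseteq> Q"
    using assms unfolding face_iff by blast
  obtain g where g: "g \<in> charts" "g \<notin> Q" using chart_exists[OF Q(1,2)] by blast
  have "F \<subseteq> supp g" using Q(3,4) g(2) by (auto simp: supp_def)
  then show ?thesis using Q g by blast
qed

text \<open>A function on the vertices that is constant along edges is a locally constant function
  on the punctured spectrum. It extends to a global \<open>h\<close>, and the class of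
  \<open>h\<close> in the residue field is the common value at all vertices.\<close>

lemma cocycle0_constant:
  fixes c :: "nat \<Rightarrow> int"
  assumes c: "\<And>i j. {i, j} \<in> D \<Longrightarrow> int p dvd c i - c j"
    and ij: "{i} \<in> D" "{j} \<in> D"
  shows "int p dvd c i - c j"
proof -
  \<comment> \<open>Any vertex would serve: the support of a chart is a face, so its vertices are
    pairwise joined by edges and carry the same value modulo \<open>p\<close>.\<close>
  define d where "d g = c (Min (supp g))" for g
  have d: "int p dvd d g - c l" if "g \<in> charts" "l \<in> supp g" for g l
  proof -
    have "Min (supp g) \<in> supp g" using that(2) finite_supp by (intro Min_in) auto
    then have "{Min (supp g), l} \<in> D" by (intro face_subset[OF charts_face[OF that(1)]]) (use that(2) in auto)
    then show ?thesis unfolding d_def by (rule c)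
  qed
  have "\<exists>h\<in>carrier R. \<forall>f\<in>charts. f \<otimes> \<guillemotleft>d f\<guillemotright> = f \<otimes> h"
  proof (rule depth_ge_3_gluing[OF depth, where \<phi> = "\<lambda>f. f"])
    show "(\<lambda>f. f) ` charts \<subseteq> carrier R" using charts_carrier by auto
    show "\<exists>N::nat. x [^] N \<in> Idl ((\<lambda>f. f) ` charts)" if "x \<in> m" for x
      using charts_radical[OF that, of 1] charts_carrier by simp
    show "f \<otimes> \<guillemotleft>d f\<guillemotright> \<in> carrier R" if "f \<in> charts" for f using charts_carrier[OF that] by simp
    show "g \<otimes> (f \<otimes> \<guillemotleft>d f\<guillemotright>) = f \<otimes> (g \<otimes> \<guillemotleft>d g\<guillemotright>)" if fg: "f \<in> charts" "g \<in> charts" for f g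
    proof -
      note fc = fg[THEN charts_carrier]
      \<comment> \<open>Either the charts share a component, and their values agree modulo
        \<open>p\<close>, or they share none, and \<open>f \<otimes> g\<close> itself is
        zero.\<close>
      have "(f \<otimes> g) \<otimes> \<guillemotleft>d f - d g\<guillemotright> = \<zero>"
      proof (cases "supp f \<inter> supp g = {}")
        case True
        then show ?thesis using chart_prod_zero[OF fg] by simp
      next
        case False
        then obtain l where l: "l \<in> supp f" "l \<in> supp g" by blast
        have "int p dvd (d f - c l) - (d g - c l)"
          by (rule dvd_diff[OF d[OF fg(1) l(1)] d[OF fg(2) l(2)]])
        then have "\<guillemotleft>d f - d g\<guillemotright> = \<zero>" by (intro of_integer_char[OF char_p]) simp
        then show ?thesis using fc by (simp del: of_int_diff)
      qed
      moreover have "(f \<otimes> g) \<otimes> \<guillemotleft>d f - d g\<guillemotright> = g \<otimes> (f \<otimes> \<guillemotleft>d f\<guillemotright>) \<ominus> f \<otimes> (g \<otimes> \<guillemotleft>d g\<guillemotright>)"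
        using fc of_int_closed[of "d f"] of_int_closed[of "d g"] unfolding of_int_diff by algebra
      ultimately have "g \<otimes> (f \<otimes> \<guillemotleft>d f\<guillemotright>) \<ominus> f \<otimes> (g \<otimes> \<guillemotleft>d g\<guillemotright>) = \<zero>" by metis
      then show ?thesis by (rule eq_diff0[THEN iffD1, rotated 2]) (use fc in simp_all)
    qed
  qed
  then obtain h where h: "h \<in> carrier R" "\<And>f. f \<in> charts \<Longrightarrow> f \<otimes> \<guillemotleft>d f\<guillemotright> = f \<otimes> h" by blast
  have *: "h \<ominus> \<guillemotleft>c l\<guillemotright> \<in> m" if l: "{l} \<in> D" for l
  proof -
    obtain g where g: "g \<in> charts" "l \<in> supp g" using face_chart[OF l] by blast
    then have gl: "l \<in> {1..n}" "g \<notin> P l" by (auto simp: supp_def)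
    note gc = charts_carrier[OF g(1)]
    have "g \<otimes> (h \<ominus> \<guillemotleft>d g\<guillemotright>) = g \<otimes> h \<ominus> g \<otimes> \<guillemotleft>d g\<guillemotright>" using gc h(1) of_int_closed[of "d g"] by algebra
    also have "\<dots> = \<zero>" using h(2)[OF g(1)] gc h(1) by (simp add: eq_diff0)
    finally have "g \<otimes> (h \<ominus> \<guillemotleft>d g\<guillemotright>) \<in> P l"
      using additive_subgroup.zero_closed[OF ideal.axioms(1)[OF primeideal.axioms(1)[OF prime_P[OF gl(1)]]]] by simp
    \<comment> \<open>Cancelling \<open>g\<close> outside \<open>P l\<close> gives the congruence
      modulo \<open>P l\<close>; weakening it to \<open>m\<close> makes all vertices comparable in
      one residue field.\<close>
    then have "h \<ominus> \<guillemotleft>d g\<guillemotright> \<in> m"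
      using primeideal_mult[OF prime_P[OF gl(1)] gc] gl(2) h(1) primeideal_le_m[OF prime_P[OF gl(1)]] by auto
    moreover have "\<guillemotleft>d g\<guillemotright> = \<guillemotleft>c l\<guillemotright>"
      using of_integer_char[OF char_p d[OF g]] eq_diff0[of "\<guillemotleft>d g\<guillemotright>" "\<guillemotleft>c l\<guillemotright>"] by simp
    ultimately show ?thesis by simp
  qed
  interpret m: primeideal m R by (rule prime_m)
  have "(h \<ominus> \<guillemotleft>c j\<guillemotright>) \<ominus> (h \<ominus> \<guillemotleft>c i\<guillemotright>) \<in> m" using *[OF ij(1)] *[OF ij(2)] by (simp add: minus_eq)
  moreover have "(h \<ominus> \<guillemotleft>c j\<guillemotright>) \<ominus> (h \<ominus> \<guillemotleft>c i\<guillemotright>) = \<guillemotleft>c i - c j\<guillemotright>"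
    using h(1) of_int_closed[of "c i"] of_int_closed[of "c j"] unfolding of_int_diff by algebra
  ultimately show ?thesis using of_integer_mem[OF prime_m] by metis
qed

lemma residue_unique:
  assumes Q: "primeideal Q R" and f: "f \<in> carrier R" "f \<notin> Q" and a: "a \<in> carrier R"
    and st: "a \<ominus> \<guillemotleft>s\<guillemotright> \<otimes> f \<in> Q" "a \<ominus> \<guillemotleft>t\<guillemotright> \<otimes> f \<in> Q"
  shows "int p dvd s - t"
proof -
  interpret Q: primeideal Q R by (rule Q)
  have "(a \<ominus> \<guillemotleft>t\<guillemotright> \<otimes> f) \<ominus> (a \<ominus> \<guillemotleft>s\<guillemotright> \<otimes> f) \<in> Q" using st by (simp add: minus_eq)
  moreover have "(a \<ominus> \<guillemotleft>t\<guillemotright> \<otimes> f) \<ominus> (a \<ominus> \<guillemotleft>s\<guillemotright> \<otimes> f) = \<guillemotleft>s - t\<guillemotright> \<otimes> f"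
    using a f(1) of_int_closed[of s] of_int_closed[of t] unfolding of_int_diff by algebra
  ultimately have "\<guillemotleft>s - t\<guillemotright> \<otimes> f \<in> Q" by simp
  then have "\<guillemotleft>s - t\<guillemotright> \<in> Q" using primeideal_mult[OF Q of_int_closed f(1)] f(2) by blast
  then show ?thesis using of_integer_mem[OF Q] by blast
qed

text \<open>Here \<open>a f / f\<close> is the section over \<open>D(f)\<close>, and the first equation says that it is fixed by
  the Frobenius map.\<close>

lemma chart_cocycle_trivial:
  fixes d :: "'a \<Rightarrow> 'a \<Rightarrow> int"
  assumes d: "\<And>f g k l. f \<in> charts \<Longrightarrow> g \<in> charts \<Longrightarrow> k \<in> charts \<Longrightarrow> l \<in> supp f \<inter> supp g \<inter> supp k \<Longrightarrow>
      int p dvd d f g - d f k + d g k"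
  shows "\<exists>a. (\<forall>f\<in>charts. a f \<in> carrier R \<and> a f [^] p = f [^] (p - 1) \<otimes> a f) \<and>
      (\<forall>f\<in>charts. \<forall>g\<in>charts. f \<otimes> g \<otimes> \<guillemotleft>d f g\<guillemotright> = g \<otimes> a f \<ominus> f \<otimes> a g)"
proof -
  have p0: "p > 0" using prime_p by (rule prime_gt_0_nat)
  note cc = charts_carrier
  have "\<exists>a. (\<forall>f\<in>charts. a f \<in> carrier R) \<and>
      (\<forall>f\<in>charts. \<forall>g\<in>charts. f \<otimes> g \<otimes> \<guillemotleft>d f g\<guillemotright> = g \<otimes> a f \<ominus> f \<otimes> a g)"
  proof (rule depth_ge_3_cocycle[OF depth])
    show "charts \<subseteq> carrier R" using cc by blast
    show "\<exists>N::nat. x [^] N \<in> Idl charts" if "x \<in> m" for x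
      using charts_radical[OF that, of 1] cc by simp
    show "f \<otimes> g \<otimes> \<guillemotleft>d f g\<guillemotright> \<in> carrier R" if "f \<in> charts" "g \<in> charts" for f g
      using that cc by simp
    fix f g k assume fgk: "f \<in> charts" "g \<in> charts" "k \<in> charts"
    note c = fgk[THEN cc]
    have "(f \<otimes> g \<otimes> k) \<otimes> \<guillemotleft>d f g - d f k + d g k\<guillemotright> = \<zero>"
    proof (cases "supp f \<inter> supp g \<inter> supp k = {}")
      case True
      then show ?thesis using chart_prod3_zero[OF fgk] by simp
    next
      case False
      then obtain l where "l \<in> supp f \<inter> supp g \<inter> supp k" by blast
      then have "\<guillemotleft>d f g - d f k + d g k\<guillemotright> = \<zero>" by (intro of_integer_char[OF char_p] d[OF fgk])
      then show ?thesis using c by (simp del: of_int_diff of_int_add)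
    qed
    moreover have "(f \<otimes> g \<otimes> k) \<otimes> \<guillemotleft>d f g - d f k + d g k\<guillemotright>
        = k \<otimes> (f \<otimes> g \<otimes> \<guillemotleft>d f g\<guillemotright>) \<ominus> (g \<otimes> (f \<otimes> k \<otimes> \<guillemotleft>d f k\<guillemotright>) \<ominus> f \<otimes> (g \<otimes> k \<otimes> \<guillemotleft>d g k\<guillemotright>))"
      using c of_int_closed[of "d f g"] of_int_closed[of "d f k"] of_int_closed[of "d g k"]
      unfolding of_int_diff of_int_add by algebra
    ultimately have "k \<otimes> (f \<otimes> g \<otimes> \<guillemotleft>d f g\<guillemotright>) \<ominus> (g \<otimes> (f \<otimes> k \<otimes> \<guillemotleft>d f k\<guillemotright>) \<ominus> f \<otimes> (g \<otimes> k \<otimes> \<guillemotleft>d g k\<guillemotright>)) = \<zero>"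
      by metis
    then show "k \<otimes> (f \<otimes> g \<otimes> \<guillemotleft>d f g\<guillemotright>) = g \<otimes> (f \<otimes> k \<otimes> \<guillemotleft>d f k\<guillemotright>) \<ominus> f \<otimes> (g \<otimes> k \<otimes> \<guillemotleft>d g k\<guillemotright>)"
      by (rule eq_diff0[THEN iffD1, rotated 2]) (use c in simp_all)
  qed
  then obtain a where a: "\<And>f. f \<in> charts \<Longrightarrow> a f \<in> carrier R"
    and da: "\<And>f g. f \<in> charts \<Longrightarrow> g \<in> charts \<Longrightarrow> f \<otimes> g \<otimes> \<guillemotleft>d f g\<guillemotright> = g \<otimes> a f \<ominus> f \<otimes> a g" by blast
  \<comment> \<open>With s = a f / f, the quotient of \<open>b f\<close> by \<open>f [^] p\<close>
    is s^p - s.\<close>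
  define b where "b f = a f [^] p \<ominus> f [^] (p - 1) \<otimes> a f" for f
  have b: "b f \<in> carrier R" if "f \<in> charts" for f using a[OF that] cc[OF that] by (simp add: b_def)
  have pw: "f [^] p = f [^] (p - 1) \<otimes> f" if "f \<in> carrier R" for f
    using p0 that by (cases p) auto
  \<comment> \<open>On an overlap the two sections differ by the integer \<open>d f g\<close>, which
    Frobenius fixes by Fermat. Hence the sections s^p - s agree there and glue.\<close>
  have "\<exists>h\<in>carrier R. \<forall>f\<in>charts. b f = f [^] p \<otimes> h"
  proof (rule depth_ge_3_gluing[OF depth _ _ b])
    show "(\<lambda>f. f [^] p) ` charts \<subseteq> carrier R" using cc by auto
    show "\<And>x. x \<in> m \<Longrightarrow> \<exists>N::nat. x [^] N \<in> Idl ((\<lambda>f. f [^] p) ` charts)"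
      using charts_radical p0 by blast
    fix f g assume fg: "f \<in> charts" "g \<in> charts"
    let ?F = "f [^] (p - 1)" and ?G = "g [^] (p - 1)" and ?d = "\<guillemotleft>d f g\<guillemotright>"
    note c = fg[THEN cc] fg[THEN a]
    have pc: "?F \<in> carrier R" "?G \<in> carrier R" "a f [^] p \<in> carrier R" "a g [^] p \<in> carrier R"
      "?d \<in> carrier R" using c by auto
    have fp: "f [^] p = ?F \<otimes> f" "g [^] p = ?G \<otimes> g" using pw c by blast+
    have "(g \<otimes> a f \<ominus> f \<otimes> a g) [^] p = g [^] p \<otimes> a f [^] p \<ominus> f [^] p \<otimes> a g [^] p"
      using frobenius_diff[OF prime_p char_p, of "g \<otimes> a f" "f \<otimes> a g"] c by (simp add: nat_pow_distrib)
    moreover have "(f \<otimes> g \<otimes> ?d) [^] p = f [^] p \<otimes> g [^] p \<otimes> ?d"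
      using c by (simp add: nat_pow_distrib of_integer_fermat[OF prime_p char_p])
    ultimately have "g [^] p \<otimes> a f [^] p \<ominus> f [^] p \<otimes> a g [^] p = f [^] p \<otimes> g [^] p \<otimes> ?d"
      using da[OF fg] by simp
    also have "\<dots> = ?F \<otimes> ?G \<otimes> (f \<otimes> g \<otimes> ?d)" unfolding fp using c pc by algebra
    also have "\<dots> = ?F \<otimes> ?G \<otimes> (g \<otimes> a f \<ominus> f \<otimes> a g)" unfolding da[OF fg] ..
    finally have eq: "g [^] p \<otimes> a f [^] p \<ominus> f [^] p \<otimes> a g [^] p = ?F \<otimes> ?G \<otimes> (g \<otimes> a f \<ominus> f \<otimes> a g)" .
    have "g [^] p \<otimes> b f \<ominus> f [^] p \<otimes> b g
        = (g [^] p \<otimes> a f [^] p \<ominus> f [^] p \<otimes> a g [^] p) \<ominus> ?F \<otimes> ?G \<otimes> (g \<otimes> a f \<ominus> f \<otimes> a g)"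
      unfolding b_def fp using c pc by algebra
    also have "\<dots> = \<zero>" unfolding eq using c pc by (simp add: eq_diff0)
    finally show "g [^] p \<otimes> b f = f [^] p \<otimes> b g"
      using c fg[THEN b] eq_diff0 by simp
  qed
  then obtain h where h: "h \<in> carrier R" "\<And>f. f \<in> charts \<Longrightarrow> b f = f [^] p \<otimes> h" by blast
  obtain r where r: "r \<in> carrier R" "r [^] p \<ominus> r = h"
    using artin_schreier[OF noeth local complete prime_p char_p sep_closed h(1)] by blast
  \<comment> \<open>Each section is shifted by the global \<open>r\<close>: differences on overlaps
    are unchanged, while s^p - s becomes zero.\<close>
  define a' where "a' f = a f \<ominus> r \<otimes> f" for f
  have "a' f \<in> carrier R \<and> a' f [^] p = f [^] (p - 1) \<otimes> a' f" if f: "f \<in> charts" for f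
  proof
    note c = f[THEN cc] f[THEN a] r(1)
    show "a' f \<in> carrier R" using c by (simp add: a'_def)
    have pc: "a f [^] p \<in> carrier R" "r [^] p \<in> carrier R" "f [^] (p - 1) \<in> carrier R" using c by auto
    have "a' f [^] p = a f [^] p \<ominus> r [^] p \<otimes> f [^] p"
      unfolding a'_def using frobenius_diff[OF prime_p char_p, of "a f" "r \<otimes> f"] c
      by (simp add: nat_pow_distrib)
    then have "a' f [^] p \<ominus> f [^] (p - 1) \<otimes> a' f = b f \<ominus> f [^] p \<otimes> (r [^] p \<ominus> r)"
      unfolding a'_def b_def pw[OF c(1)] using c pc by algebra
    also have "\<dots> = \<zero>" unfolding r(2) h(2)[OF f] using c h(1) by (simp add: eq_diff0)
    finally show "a' f [^] p = f [^] (p - 1) \<otimes> a' f" using c eq_diff0 by (simp add: a'_def)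
  qed
  moreover have "f \<otimes> g \<otimes> \<guillemotleft>d f g\<guillemotright> = g \<otimes> a' f \<ominus> f \<otimes> a' g" if fg: "f \<in> charts" "g \<in> charts" for f g
    unfolding da[OF fg] a'_def using fg[THEN cc] fg[THEN a] r(1) by algebra
  ultimately show ?thesis by blast
qed

text \<open>On the face cut out by a chart \<open>g\<close> the cocycle is trivial, with primitive
  \<open>b g\<close>. Differences of these primitives form a Cech cocycle \<open>d\<close>, which is
  also the difference of the values \<open>e\<close> of Frobenius-fixed sections. Hence b g - e g
  does not depend on the chart and is a global primitive, since \<open>e g\<close> is constant along
  edges.\<close>

lemma cocycle1_coboundary:
  fixes c :: "nat \<Rightarrow> nat \<Rightarrow> int"
  assumes c: "\<And>i j k. {i, j, k} \<in> D \<Longrightarrow> int p dvd c i j + c j k - c i k"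
  shows "\<exists>a. \<forall>i j. {i, j} \<in> D \<longrightarrow> int p dvd c i j - (a j - a i)"
proof -
  \<comment> \<open>The cone construction with the least vertex of the simplex \<open>supp g\<close>
    as apex.\<close>
  define b where "b g i = c (Min (supp g)) i" for g i
  have b: "int p dvd b g i + c i j - b g j" if "g \<in> charts" "i \<in> supp g" "j \<in> supp g" for g i j
  proof -
    have "Min (supp g) \<in> supp g" using that(2) finite_supp by (intro Min_in) auto
    then have "{Min (supp g), i, j} \<in> D"
      by (intro face_subset[OF charts_face[OF that(1)]]) (use that in auto)
    then show ?thesis unfolding b_def by (rule c)
  qed
  \<comment> \<open>Any common vertex gives the same value modulo \<open>p\<close>. For disjoint
    supports the minimum is unspecified, which is harmless because \<open>f \<otimes> g\<close> is
    then zero.\<close>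
  define d where "d f g = b f (Min (supp f \<inter> supp g)) - b g (Min (supp f \<inter> supp g))" for f g
  have d: "int p dvd d f g - (b f l - b g l)"
    if fg: "f \<in> charts" "g \<in> charts" and l: "l \<in> supp f" "l \<in> supp g" for f g l
  proof -
    let ?j = "Min (supp f \<inter> supp g)"
    have "?j \<in> supp f \<inter> supp g" using l finite_supp by (intro Min_in) auto
    then have "int p dvd (b f ?j + c ?j l - b f l) - (b g ?j + c ?j l - b g l)"
      using b fg l by (intro dvd_diff[OF b b]) auto
    then show ?thesis by (simp add: d_def algebra_simps)
  qed
  have dcoc: "int p dvd d f g - d f k + d g k"
    if "f \<in> charts" "g \<in> charts" "k \<in> charts" "l \<in> supp f \<inter> supp g \<inter> supp k" for f g k l
  proof -
    have "int p dvd (d f g - (b f l - b g l)) - (d f k - (b f l - b k l)) + (d g k - (b g l - b k l))"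
      using that by (intro dvd_add dvd_diff d) auto
    then show ?thesis by (simp add: algebra_simps)
  qed
  have "\<exists>a. (\<forall>f\<in>charts. a f \<in> carrier R \<and> a f [^] p = f [^] (p - 1) \<otimes> a f) \<and>
      (\<forall>f\<in>charts. \<forall>g\<in>charts. f \<otimes> g \<otimes> \<guillemotleft>d f g\<guillemotright> = g \<otimes> a f \<ominus> f \<otimes> a g)"
    by (rule chart_cocycle_trivial) (rule dcoc)
  then obtain a where A: "\<forall>f\<in>charts. a f \<in> carrier R \<and> a f [^] p = f [^] (p - 1) \<otimes> a f"
      "\<forall>f\<in>charts. \<forall>g\<in>charts. f \<otimes> g \<otimes> \<guillemotleft>d f g\<guillemotright> = g \<otimes> a f \<ominus> f \<otimes> a g"
    by blast
  have a: "\<And>f. f \<in> charts \<Longrightarrow> a f \<in> carrier R"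
      "\<And>f. f \<in> charts \<Longrightarrow> a f [^] p = f [^] (p - 1) \<otimes> a f"
    and da: "\<And>f g. f \<in> charts \<Longrightarrow> g \<in> charts \<Longrightarrow> f \<otimes> g \<otimes> \<guillemotleft>d f g\<guillemotright> = g \<otimes> a f \<ominus> f \<otimes> a g"
    using A by blast+
  \<comment> \<open>The value in the prime field of the section a f / f at the generic point of the
    component \<open>l\<close>.\<close>
  define e where "e f l = (SOME t. a f \<ominus> \<guillemotleft>t\<guillemotright> \<otimes> f \<in> P l)" for f l
  have suppD: "l \<in> {1..n}" "f \<notin> P l" if "l \<in> supp f" for l f using that by (auto simp: supp_def)
  have e: "a f \<ominus> \<guillemotleft>e f l\<guillemotright> \<otimes> f \<in> P l" if f: "f \<in> charts" and l: "l \<in> supp f" for f l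
  proof -
    have "\<exists>t. a f \<ominus> \<guillemotleft>t\<guillemotright> \<otimes> f \<in> P l"
      by (rule prime_field_residue[OF prime_p char_p prime_P[OF suppD(1)[OF l]] a(1)[OF f]
            charts_carrier[OF f] suppD(2)[OF l] a(2)[OF f]])
    then show ?thesis unfolding e_def by (rule someI_ex)
  qed
  have de: "int p dvd d f g - (e f l - e g l)"
    if fg: "f \<in> charts" "g \<in> charts" and l: "l \<in> supp f" "l \<in> supp g" for f g l
  proof -
    note cs = fg[THEN charts_carrier] fg[THEN a(1)] of_int_closed[of "d f g"]
      of_int_closed[of "e f l"] of_int_closed[of "e g l"]
    interpret Pl: primeideal "P l" R by (rule prime_P[OF suppD(1)[OF l(1)]])
    have "g \<otimes> (a f \<ominus> \<guillemotleft>e f l\<guillemotright> \<otimes> f) \<ominus> f \<otimes> (a g \<ominus> \<guillemotleft>e g l\<guillemotright> \<otimes> g) \<in> P l"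
      using Pl.I_l_closed[OF e[OF fg(1) l(1)] cs(2)] Pl.I_l_closed[OF e[OF fg(2) l(2)] cs(1)]
      by (simp add: minus_eq)
    moreover have "g \<otimes> (a f \<ominus> \<guillemotleft>e f l\<guillemotright> \<otimes> f) \<ominus> f \<otimes> (a g \<ominus> \<guillemotleft>e g l\<guillemotright> \<otimes> g)
        = (g \<otimes> a f \<ominus> f \<otimes> a g) \<ominus> (f \<otimes> g) \<otimes> (\<guillemotleft>e f l\<guillemotright> \<ominus> \<guillemotleft>e g l\<guillemotright>)"
      using cs by algebra
    moreover have "\<dots> = (f \<otimes> g) \<otimes> \<guillemotleft>d f g - (e f l - e g l)\<guillemotright>"
      unfolding da[OF fg, symmetric] of_int_diff using cs by algebra
    ultimately have "(f \<otimes> g) \<otimes> \<guillemotleft>d f g - (e f l - e g l)\<guillemotright> \<in> P l" by simp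
    then have "\<guillemotleft>d f g - (e f l - e g l)\<guillemotright> \<in> P l"
      using suppD(2)[OF l(1)] suppD(2)[OF l(2)] primeideal_mult[OF Pl.primeideal] cs(1,2) of_int_closed
        m_closed by metis
    then show ?thesis using of_integer_mem[OF Pl.primeideal] by blast
  qed
  define s where "s l = (SOME g. g \<in> charts \<and> l \<in> supp g)" for l
  \<comment> \<open>The chart \<open>s l\<close> is an arbitrary one meeting the component
    \<open>l\<close>; independence of this choice holds because b f - b g and e f - e g are both
    congruent to \<open>d f g\<close>.\<close>
  define A where "A l = b (s l) l - e (s l) l" for l
  have A: "int p dvd A l - (b g l - e g l)" if g: "g \<in> charts" "l \<in> supp g" for g l
  proof -
    have "s l \<in> charts \<and> l \<in> supp (s l)" unfolding s_def by (rule someI[of _ g]) (use g in simp)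
    then have "int p dvd (d (s l) g - (e (s l) l - e g l)) - (d (s l) g - (b (s l) l - b g l))"
      using g by (intro dvd_diff d de) auto
    then show ?thesis by (simp add: A_def algebra_simps)
  qed
  have "int p dvd c i j - (A j - A i)" if ij: "{i, j} \<in> D" for i j
  proof -
    obtain Q g where Q: "primeideal Q R" and g: "g \<in> charts" "g \<notin> Q" "i \<in> supp g" "j \<in> supp g"
      and PQ: "P i \<subseteq> Q" "P j \<subseteq> Q"
      using face_chart[OF ij] by blast
    \<comment> \<open>Both \<open>e g i\<close> and \<open>e g j\<close> are the value of the same
      section at \<open>Q\<close>, where the two components meet and the denominator
      \<open>g\<close> does not vanish.\<close>
    have E: "int p dvd e g j - e g i"
      using residue_unique[OF Q charts_carrier[OF g(1)] g(2) a(1)[OF g(1)]] e[OF g(1)] g(3,4) PQ by blast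
    have "int p dvd (b g i + c i j - b g j) - (A j - (b g j - e g j)) + (A i - (b g i - e g i))
        + (e g j - e g i)"
      by (rule dvd_add[OF dvd_add[OF dvd_diff[OF b[OF g(1,3,4)] A[OF g(1,4)]] A[OF g(1,3)]] E])
    then show ?thesis by (simp add: algebra_simps)
  qed
  then show ?thesis by blast
qed

end

section \<open>Homology with field coefficients from cohomology modulo a prime\<close>

text \<open>Integer entries make a single matrix serve twice: its image in a field gives the
  boundary map, and its transpose modulo \<open>p\<close> gives the coboundary.\<close>

definition incidence :: "nat set \<Rightarrow> nat set \<Rightarrow> int" where
  "incidence \<sigma> \<tau> = (if \<tau> \<subseteq> \<sigma> then (if even (card {u \<in> \<sigma>. u < the_elem (\<sigma> - \<tau>)}) then 1 else -1) else 0)"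

lemma (in ring) finsum_swap:
  assumes "finite A" "finite B" "\<And>i j. i \<in> A \<Longrightarrow> j \<in> B \<Longrightarrow> f i j \<in> carrier R"
  shows "(\<Oplus>i\<in>A. \<Oplus>j\<in>B. f i j) = (\<Oplus>j\<in>B. \<Oplus>i\<in>A. f i j)"
  using assms(1,3)
proof (induction A rule: finite_induct)
  case empty
  then show ?case by (simp add: finsum_zero)
next
  case (insert a A)
  have "(\<Oplus>i\<in>insert a A. \<Oplus>j\<in>B. f i j) = (\<Oplus>j\<in>B. f a j) \<oplus> (\<Oplus>i\<in>A. \<Oplus>j\<in>B. f i j)"
    using insert by (subst finsum_insert) (auto intro!: finsum_closed)
  also have "\<dots> = (\<Oplus>j\<in>B. f a j) \<oplus> (\<Oplus>j\<in>B. \<Oplus>i\<in>A. f i j)"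
    using insert by simp
  also have "\<dots> = (\<Oplus>j\<in>B. f a j \<oplus> (\<Oplus>i\<in>A. f i j))"
    using insert by (intro finsum_addf[symmetric]) (auto intro!: finsum_closed)
  also have "\<dots> = (\<Oplus>j\<in>B. \<Oplus>i\<in>insert a A. f i j)"
    using insert by (intro finsum_cong') (auto intro!: finsum_closed)
  finally show ?case .
qed

lemma (in ring) of_integer_sum:
  "finite A \<Longrightarrow> \<guillemotleft>sum f A\<guillemotright> = (\<Oplus>i\<in>A. \<guillemotleft>f i\<guillemotright>)"
  by (induction A rule: finite_induct) simp_all

text \<open>Linear duality, arranged so that the obstruction to solving an integral system over \<open>R\<close>
  is a functional with coefficients in the prime field.\<close>

lemma (in field) integral_system_solvable_or_obstructed:
  fixes v :: "'j \<Rightarrow> 'i \<Rightarrow> int"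
  assumes p: "Factorial_Ring.prime p" and zero: "\<And>i. \<guillemotleft>i\<guillemotright> = \<zero> \<longleftrightarrow> int p dvd i"
    and I: "finite I" and J: "finite J" and b: "b \<in> I \<rightarrow> carrier R"
  shows "(\<exists>e\<in>J \<rightarrow> carrier R. \<forall>i\<in>I. b i = (\<Oplus>j\<in>J. e j \<otimes> \<guillemotleft>v j i\<guillemotright>)) \<or>
    (\<exists>y. (\<forall>j\<in>J. int p dvd (\<Sum>i\<in>I. y i * v j i)) \<and> (\<Oplus>i\<in>I. \<guillemotleft>y i\<guillemotright> \<otimes> b i) \<noteq> \<zero>)"
  using J b
proof (induction J arbitrary: b rule: finite_induct)
  case empty
  show ?case
  proof (cases "\<forall>i\<in>I. b i = \<zero>")
    case False
    then obtain k where k: "k \<in> I" "b k \<noteq> \<zero>" by blast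
    \<comment> \<open>With no columns available, a nonzero coordinate of \<open>b\<close> is itself
      an obstruction.\<close>
    have "(\<Oplus>i\<in>I. \<guillemotleft>if k = i then 1 else 0\<guillemotright> \<otimes> b i) = (\<Oplus>i\<in>I. if k = i then b i else \<zero>)"
      using empty by (intro finsum_cong') (auto simp: Pi_iff)
    also have "\<dots> = b k" using k I empty by (intro finsum_singleton) auto
    finally show ?thesis using k(2) by (intro disjI2 exI[of _ "\<lambda>i. if k = i then 1 else 0"]) simp
  qed simp
next
  case (insert k J)
  have extend: ?case if e: "e \<in> J \<rightarrow> carrier R" and \<beta>: "\<beta> \<in> carrier R"
    and eq: "\<And>i. i \<in> I \<Longrightarrow> b i = \<beta> \<otimes> \<guillemotleft>v k i\<guillemotright> \<oplus> (\<Oplus>j\<in>J. e j \<otimes> \<guillemotleft>v j i\<guillemotright>)" for e \<beta>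
  proof -
    let ?e = "e(k := \<beta>)"
    have "(\<Oplus>j\<in>insert k J. ?e j \<otimes> \<guillemotleft>v j i\<guillemotright>) = \<beta> \<otimes> \<guillemotleft>v k i\<guillemotright> \<oplus> (\<Oplus>j\<in>J. e j \<otimes> \<guillemotleft>v j i\<guillemotright>)" for i
    proof -
      have "(\<Oplus>j\<in>J. ?e j \<otimes> \<guillemotleft>v j i\<guillemotright>) = (\<Oplus>j\<in>J. e j \<otimes> \<guillemotleft>v j i\<guillemotright>)"
        using e insert.hyps by (intro finsum_cong') auto
      then show ?thesis using e \<beta> insert.hyps by (subst finsum_insert) (auto simp: Pi_iff)
    qed
    moreover have "?e \<in> insert k J \<rightarrow> carrier R" using e \<beta> by auto
    ultimately show ?thesis using eq by (intro disjI1 bexI[of _ ?e]) auto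
  qed
  have vk: "(\<lambda>i. \<guillemotleft>v k i\<guillemotright>) \<in> I \<rightarrow> carrier R" by simp
  have eval: "(\<Oplus>i\<in>I. \<guillemotleft>y i\<guillemotright> \<otimes> \<guillemotleft>v k i\<guillemotright>) = \<guillemotleft>\<Sum>i\<in>I. y i * v k i\<guillemotright>" for y
    using I by (simp add: of_integer_sum)
  \<comment> \<open>The induction hypothesis is first applied to the new column: either it depends
    on the old columns, or a functional with integer coefficients separates it from them.\<close>
  from insert.IH[OF vk] show ?case
  proof
    assume "\<exists>e\<in>J \<rightarrow> carrier R. \<forall>i\<in>I. \<guillemotleft>v k i\<guillemotright> = (\<Oplus>j\<in>J. e j \<otimes> \<guillemotleft>v j i\<guillemotright>)"
    then obtain e where e: "e \<in> J \<rightarrow> carrier R" "\<And>i. i \<in> I \<Longrightarrow> \<guillemotleft>v k i\<guillemotright> = (\<Oplus>j\<in>J. e j \<otimes> \<guillemotleft>v j i\<guillemotright>)" by blast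
    from insert.IH[OF insert.prems] show ?case
    proof
      assume "\<exists>e\<in>J \<rightarrow> carrier R. \<forall>i\<in>I. b i = (\<Oplus>j\<in>J. e j \<otimes> \<guillemotleft>v j i\<guillemotright>)"
      then obtain e where "e \<in> J \<rightarrow> carrier R" "\<And>i. i \<in> I \<Longrightarrow> b i = (\<Oplus>j\<in>J. e j \<otimes> \<guillemotleft>v j i\<guillemotright>)" by blast
      then show ?case by (intro extend[of e \<zero>]) (simp_all add: Pi_iff finsum_closed)
    next
      assume "\<exists>y. (\<forall>j\<in>J. int p dvd (\<Sum>i\<in>I. y i * v j i)) \<and> (\<Oplus>i\<in>I. \<guillemotleft>y i\<guillemotright> \<otimes> b i) \<noteq> \<zero>"
      then obtain y where y: "\<And>j. j \<in> J \<Longrightarrow> int p dvd (\<Sum>i\<in>I. y i * v j i)" "(\<Oplus>i\<in>I. \<guillemotleft>y i\<guillemotright> \<otimes> b i) \<noteq> \<zero>" by blast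
      \<comment> \<open>A functional that kills the old columns also kills the dependent new one, so
        the old obstruction persists.\<close>
      have "\<guillemotleft>\<Sum>i\<in>I. y i * v k i\<guillemotright> = (\<Oplus>i\<in>I. \<guillemotleft>y i\<guillemotright> \<otimes> (\<Oplus>j\<in>J. e j \<otimes> \<guillemotleft>v j i\<guillemotright>))"
        unfolding eval[symmetric] using e by (intro finsum_cong') (auto simp: Pi_iff intro!: finsum_closed)
      also have "\<dots> = (\<Oplus>i\<in>I. \<Oplus>j\<in>J. e j \<otimes> \<guillemotleft>y i * v j i\<guillemotright>)"
      proof (intro finsum_cong')
        fix i assume "i \<in> I"
        have "\<guillemotleft>y i\<guillemotright> \<otimes> (\<Oplus>j\<in>J. e j \<otimes> \<guillemotleft>v j i\<guillemotright>) = (\<Oplus>j\<in>J. \<guillemotleft>y i\<guillemotright> \<otimes> (e j \<otimes> \<guillemotleft>v j i\<guillemotright>))"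
          using e insert.hyps by (intro finsum_rdistr) auto
        also have "\<dots> = (\<Oplus>j\<in>J. e j \<otimes> \<guillemotleft>y i * v j i\<guillemotright>)"
          using e(1) by (intro finsum_cong') (auto simp: m_ac Pi_iff)
        finally show "\<guillemotleft>y i\<guillemotright> \<otimes> (\<Oplus>j\<in>J. e j \<otimes> \<guillemotleft>v j i\<guillemotright>) = (\<Oplus>j\<in>J. e j \<otimes> \<guillemotleft>y i * v j i\<guillemotright>)" .
      qed (use e(1) in \<open>auto simp: Pi_iff intro!: finsum_closed\<close>)
      also have "\<dots> = (\<Oplus>j\<in>J. \<Oplus>i\<in>I. e j \<otimes> \<guillemotleft>y i * v j i\<guillemotright>)"
        using e(1) I insert.hyps by (intro finsum_swap) auto
      also have "\<dots> = (\<Oplus>j\<in>J. \<zero>)"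
      proof (intro finsum_cong')
        fix j assume j: "j \<in> J"
        have "(\<Oplus>i\<in>I. e j \<otimes> \<guillemotleft>y i * v j i\<guillemotright>) = e j \<otimes> \<guillemotleft>\<Sum>i\<in>I. y i * v j i\<guillemotright>"
          unfolding of_integer_sum[OF I] using e(1) j I by (intro finsum_rdistr[symmetric]) auto
        also have "\<guillemotleft>\<Sum>i\<in>I. y i * v j i\<guillemotright> = \<zero>" using y(1)[OF j] zero by blast
        finally show "(\<Oplus>i\<in>I. e j \<otimes> \<guillemotleft>y i * v j i\<guillemotright>) = \<zero>"
          using funcset_mem[OF e(1) j] by simp
      qed auto
      finally have "\<guillemotleft>\<Sum>i\<in>I. y i * v k i\<guillemotright> = \<zero>" by (simp add: finsum_zero)
      then have "int p dvd (\<Sum>i\<in>I. y i * v k i)" using zero by blast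
      then show ?case using y by (intro disjI2 exI[of _ y]) auto
    qed
  next
    assume "\<exists>y. (\<forall>j\<in>J. int p dvd (\<Sum>i\<in>I. y i * v j i)) \<and> (\<Oplus>i\<in>I. \<guillemotleft>y i\<guillemotright> \<otimes> \<guillemotleft>v k i\<guillemotright>) \<noteq> \<zero>"
    then obtain y0 where y0: "\<And>j. j \<in> J \<Longrightarrow> int p dvd (\<Sum>i\<in>I. y0 i * v j i)"
      "\<not> int p dvd (\<Sum>i\<in>I. y0 i * v k i)"
      unfolding eval zero by blast
    have "coprime (\<Sum>i\<in>I. y0 i * v k i) (int p)"
      using y0(2) p by (metis coprime_commute prime_imp_coprime prime_nat_int_transfer)
    then obtain t where "[(\<Sum>i\<in>I. y0 i * v k i) * t = 1] (mod int p)"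
      using cong_solve_coprime_int by blast
    then have t: "int p dvd t * (\<Sum>i\<in>I. y0 i * v k i) - 1" by (simp add: cong_iff_dvd_diff mult.commute)
    \<comment> \<open>Normalised to take the value 1 modulo \<open>p\<close> on the new column while
      killing the old ones; its value \<beta> on \<open>b\<close> is then the coefficient that any
      solution must give to the new column.\<close>
    define y1 where "y1 i = t * y0 i" for i
    have y1: "int p dvd (\<Sum>i\<in>I. y1 i * v j i)" if "j \<in> J" for j
      using dvd_mult[OF y0(1)[OF that], of t] by (simp add: y1_def sum_distrib_left mult.assoc)
    have y1k: "int p dvd (\<Sum>i\<in>I. y1 i * v k i) - 1"
      using t by (simp add: y1_def sum_distrib_left mult.assoc)
    define \<beta> where "\<beta> = (\<Oplus>i\<in>I. \<guillemotleft>y1 i\<guillemotright> \<otimes> b i)"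
    have bc: "b i \<in> carrier R" if "i \<in> I" for i using insert.prems that by auto
    have \<beta>: "\<beta> \<in> carrier R" unfolding \<beta>_def using bc by (intro finsum_closed) auto
    have b': "(\<lambda>i. b i \<ominus> \<beta> \<otimes> \<guillemotleft>v k i\<guillemotright>) \<in> I \<rightarrow> carrier R" using bc \<beta> by auto
    from insert.IH[OF b'] show ?case
    proof
      assume "\<exists>e\<in>J \<rightarrow> carrier R. \<forall>i\<in>I. b i \<ominus> \<beta> \<otimes> \<guillemotleft>v k i\<guillemotright> = (\<Oplus>j\<in>J. e j \<otimes> \<guillemotleft>v j i\<guillemotright>)"
      then obtain e where e: "e \<in> J \<rightarrow> carrier R"
        "\<And>i. i \<in> I \<Longrightarrow> b i \<ominus> \<beta> \<otimes> \<guillemotleft>v k i\<guillemotright> = (\<Oplus>j\<in>J. e j \<otimes> \<guillemotleft>v j i\<guillemotright>)" by blast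
      show ?case
      proof (rule extend[OF e(1) \<beta>])
        fix i assume i: "i \<in> I"
        show "b i = \<beta> \<otimes> \<guillemotleft>v k i\<guillemotright> \<oplus> (\<Oplus>j\<in>J. e j \<otimes> \<guillemotleft>v j i\<guillemotright>)"
          unfolding e(2)[OF i, symmetric] using bc[OF i] \<beta> of_int_closed[of "v k i"] by algebra
      qed
    next
      assume "\<exists>y. (\<forall>j\<in>J. int p dvd (\<Sum>i\<in>I. y i * v j i)) \<and>
        (\<Oplus>i\<in>I. \<guillemotleft>y i\<guillemotright> \<otimes> (b i \<ominus> \<beta> \<otimes> \<guillemotleft>v k i\<guillemotright>)) \<noteq> \<zero>"
      then obtain y where y: "\<And>j. j \<in> J \<Longrightarrow> int p dvd (\<Sum>i\<in>I. y i * v j i)"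
        "(\<Oplus>i\<in>I. \<guillemotleft>y i\<guillemotright> \<otimes> (b i \<ominus> \<beta> \<otimes> \<guillemotleft>v k i\<guillemotright>)) \<noteq> \<zero>" by blast
      define w where "w = (\<Sum>i\<in>I. y i * v k i)"
      \<comment> \<open>The correction makes the functional vanish modulo \<open>p\<close> on the
        new column too; its value on \<open>b\<close> equals that of \<open>y\<close> on
        \<open>b\<close> minus \<beta> times the column, hence is nonzero.\<close>
      define y' where "y' i = y i - w * y1 i" for i
      have sum_y': "(\<Sum>i\<in>I. y' i * v j i) = (\<Sum>i\<in>I. y i * v j i) - w * (\<Sum>i\<in>I. y1 i * v j i)" for j
        by (simp add: y'_def left_diff_distrib sum_subtractf sum_distrib_left mult.assoc)
      have "(\<Sum>i\<in>I. y' i * v k i) = - w * ((\<Sum>i\<in>I. y1 i * v k i) - 1)"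
        unfolding sum_y' w_def[symmetric] by (simp add: algebra_simps)
      then have y'k: "int p dvd (\<Sum>i\<in>I. y' i * v k i)" using y1k by (metis dvd_mult)
      have y'J: "int p dvd (\<Sum>i\<in>I. y' i * v j i)" if "j \<in> J" for j
        unfolding sum_y' using y(1)[OF that] y1[OF that] by (intro dvd_diff dvd_mult)
      let ?Y = "\<Oplus>i\<in>I. \<guillemotleft>y i\<guillemotright> \<otimes> b i"
      have Yc: "?Y \<in> carrier R" using bc by (intro finsum_closed) auto
      have "(\<Oplus>i\<in>I. \<guillemotleft>y i\<guillemotright> \<otimes> (b i \<ominus> \<beta> \<otimes> \<guillemotleft>v k i\<guillemotright>)) = (\<Oplus>i\<in>I. \<guillemotleft>y i\<guillemotright> \<otimes> b i \<oplus> (\<ominus> \<beta>) \<otimes> \<guillemotleft>y i * v k i\<guillemotright>)"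
      proof (intro finsum_cong')
        fix i assume i: "i \<in> I"
        show "\<guillemotleft>y i\<guillemotright> \<otimes> (b i \<ominus> \<beta> \<otimes> \<guillemotleft>v k i\<guillemotright>) = \<guillemotleft>y i\<guillemotright> \<otimes> b i \<oplus> (\<ominus> \<beta>) \<otimes> \<guillemotleft>y i * v k i\<guillemotright>"
          unfolding of_int_mult using bc[OF i] \<beta> of_int_closed[of "v k i"] of_int_closed[of "y i"] by algebra
      qed (use bc \<beta> in auto)
      also have "\<dots> = ?Y \<oplus> (\<Oplus>i\<in>I. (\<ominus> \<beta>) \<otimes> \<guillemotleft>y i * v k i\<guillemotright>)"
        using bc \<beta> by (intro finsum_addf) auto
      also have "(\<Oplus>i\<in>I. (\<ominus> \<beta>) \<otimes> \<guillemotleft>y i * v k i\<guillemotright>) = (\<ominus> \<beta>) \<otimes> \<guillemotleft>w\<guillemotright>"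
        unfolding w_def of_integer_sum[OF I] using \<beta> I by (intro finsum_rdistr[symmetric]) auto
      finally have 1: "(\<Oplus>i\<in>I. \<guillemotleft>y i\<guillemotright> \<otimes> (b i \<ominus> \<beta> \<otimes> \<guillemotleft>v k i\<guillemotright>)) = ?Y \<oplus> (\<ominus> \<beta>) \<otimes> \<guillemotleft>w\<guillemotright>" .
      have "(\<Oplus>i\<in>I. \<guillemotleft>y' i\<guillemotright> \<otimes> b i) = (\<Oplus>i\<in>I. \<guillemotleft>y i\<guillemotright> \<otimes> b i \<oplus> (\<ominus> \<guillemotleft>w\<guillemotright>) \<otimes> (\<guillemotleft>y1 i\<guillemotright> \<otimes> b i))"
      proof (intro finsum_cong')
        fix i assume i: "i \<in> I"
        show "\<guillemotleft>y' i\<guillemotright> \<otimes> b i = \<guillemotleft>y i\<guillemotright> \<otimes> b i \<oplus> (\<ominus> \<guillemotleft>w\<guillemotright>) \<otimes> (\<guillemotleft>y1 i\<guillemotright> \<otimes> b i)"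
          unfolding y'_def of_int_mult of_int_diff
          using bc[OF i] of_int_closed[of "y i"] of_int_closed[of "y1 i"] of_int_closed[of w] by algebra
      qed (use bc in auto)
      also have "\<dots> = ?Y \<oplus> (\<Oplus>i\<in>I. (\<ominus> \<guillemotleft>w\<guillemotright>) \<otimes> (\<guillemotleft>y1 i\<guillemotright> \<otimes> b i))"
        using bc by (intro finsum_addf) auto
      also have "(\<Oplus>i\<in>I. (\<ominus> \<guillemotleft>w\<guillemotright>) \<otimes> (\<guillemotleft>y1 i\<guillemotright> \<otimes> b i)) = (\<ominus> \<guillemotleft>w\<guillemotright>) \<otimes> \<beta>"
        unfolding \<beta>_def using bc I by (intro finsum_rdistr[symmetric]) auto
      also have "(\<ominus> \<guillemotleft>w\<guillemotright>) \<otimes> \<beta> = (\<ominus> \<beta>) \<otimes> \<guillemotleft>w\<guillemotright>" using \<beta> of_int_closed[of w] by algebra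
      finally have "(\<Oplus>i\<in>I. \<guillemotleft>y' i\<guillemotright> \<otimes> b i) \<noteq> \<zero>" using 1 y(2) by simp
      then show ?case using y'k y'J by (intro disjI2 exI[of _ y']) auto
    qed
  qed
qed

lemma (in field) bdry_eq_incidence:
  assumes fin: "finite (faces D (Suc d))" and e: "\<And>\<sigma>. \<sigma> \<in> faces D (Suc d) \<Longrightarrow> e \<sigma> \<in> carrier R"
    and \<tau>: "\<tau> \<in> faces D d"
  shows "bdry R D d e \<tau> = (\<Oplus>\<sigma>\<in>faces D (Suc d). e \<sigma> \<otimes> \<guillemotleft>incidence \<sigma> \<tau>\<guillemotright>)"
proof -
  let ?g = "\<lambda>\<sigma>. if even (card {u \<in> \<sigma>. u < the_elem (\<sigma> - \<tau>)}) then e \<sigma> else \<ominus> e \<sigma>"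
  have "(\<Oplus>\<sigma>\<in>{\<sigma> \<in> faces D (Suc d). \<tau> \<subseteq> \<sigma>}. ?g \<sigma>) = (\<Oplus>\<sigma>\<in>faces D (Suc d). e \<sigma> \<otimes> \<guillemotleft>incidence \<sigma> \<tau>\<guillemotright>)"
  proof (rule add.finprod_mono_neutral_cong_left)
    show "e \<sigma> \<otimes> \<guillemotleft>incidence \<sigma> \<tau>\<guillemotright> = \<zero>"
      if "\<sigma> \<in> faces D (Suc d) - {\<sigma> \<in> faces D (Suc d). \<tau> \<subseteq> \<sigma>}" for \<sigma>
      using that e by (simp add: incidence_def)
    show "?g \<sigma> = e \<sigma> \<otimes> \<guillemotleft>incidence \<sigma> \<tau>\<guillemotright>" if "\<sigma> \<in> {\<sigma> \<in> faces D (Suc d). \<tau> \<subseteq> \<sigma>}" for \<sigma>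
      using that e by (simp add: incidence_def r_minus)
  qed (use fin e in auto)
  then show ?thesis using \<tau> by (simp add: bdry_def)
qed

text \<open>If the cycle \<open>c\<close> were not a boundary, duality would give a cocycle
  \<open>y\<close> modulo \<open>p\<close> with nonzero pairing against \<open>c\<close>. But
  \<open>y\<close> is the coboundary of some \<open>a\<close>, and the pairing of \<open>y\<close>
  with \<open>c\<close> equals that of \<open>a\<close> with the boundary of \<open>c\<close>, which
  is zero.\<close>

lemma (in field) reduced_homology_zeroI:
  assumes p: "Factorial_Ring.prime p" and zero: "\<And>i. \<guillemotleft>i\<guillemotright> = \<zero> \<longleftrightarrow> int p dvd i"
    and fin: "finite D"
    and cohomology: "\<And>y. (\<And>\<sigma>. \<sigma> \<in> faces D (Suc (Suc j)) \<Longrightarrow>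
        int p dvd (\<Sum>\<tau>\<in>faces D (Suc j). y \<tau> * incidence \<sigma> \<tau>)) \<Longrightarrow>
      \<exists>a. \<forall>\<tau>\<in>faces D (Suc j). int p dvd y \<tau> - (\<Sum>\<rho>\<in>faces D j. a \<rho> * incidence \<tau> \<rho>)"
  shows "reduced_homology_zero R D j"
  unfolding reduced_homology_zero_def
proof (intro ballI impI)
  fix c assume c: "c \<in> chains R D (Suc j)" and cycle: "bdry R D j c = (\<lambda>_. \<zero>)"
  have finf: "finite (faces D d)" for d using fin by (auto simp: faces_def)
  let ?I = "faces D (Suc j)" and ?J = "faces D (Suc (Suc j))" and ?K = "faces D j"
  have cc: "c \<tau> \<in> carrier R" if "\<tau> \<in> ?I" for \<tau> using c that by (simp add: chains_def)
  then have "c \<in> ?I \<rightarrow> carrier R" by blast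
  from integral_system_solvable_or_obstructed[OF p zero finf finf this, of "Suc (Suc j)" incidence]
  show "\<exists>e\<in>chains R D (Suc (Suc j)). bdry R D (Suc j) e = c"
  proof
    assume "\<exists>e\<in>?J \<rightarrow> carrier R. \<forall>\<tau>\<in>?I. c \<tau> = (\<Oplus>\<sigma>\<in>?J. e \<sigma> \<otimes> \<guillemotleft>incidence \<sigma> \<tau>\<guillemotright>)"
    then obtain e where e: "e \<in> ?J \<rightarrow> carrier R"
      "\<And>\<tau>. \<tau> \<in> ?I \<Longrightarrow> c \<tau> = (\<Oplus>\<sigma>\<in>?J. e \<sigma> \<otimes> \<guillemotleft>incidence \<sigma> \<tau>\<guillemotright>)" by blast
    define e' where "e' \<sigma> = (if \<sigma> \<in> ?J then e \<sigma> else \<zero>)" for \<sigma>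
    have "bdry R D (Suc j) e' \<tau> = c \<tau>" for \<tau>
    proof (cases "\<tau> \<in> ?I")
      case True
      have "bdry R D (Suc j) e' \<tau> = (\<Oplus>\<sigma>\<in>?J. e' \<sigma> \<otimes> \<guillemotleft>incidence \<sigma> \<tau>\<guillemotright>)"
        using e(1) True finf by (intro bdry_eq_incidence) (auto simp: e'_def)
      also have "\<dots> = c \<tau>"
        unfolding e(2)[OF True] using e(1) by (intro finsum_cong') (auto simp: e'_def)
      finally show ?thesis .
    next
      case False
      then show ?thesis using c by (simp add: bdry_def chains_def)
    qed
    moreover have "e' \<in> chains R D (Suc (Suc j))"
      using e(1) by (auto simp: chains_def e'_def)
    ultimately show ?thesis by blast
  next
    assume "\<exists>y. (\<forall>\<sigma>\<in>?J. int p dvd (\<Sum>\<tau>\<in>?I. y \<tau> * incidence \<sigma> \<tau>)) \<and> (\<Oplus>\<tau>\<in>?I. \<guillemotleft>y \<tau>\<guillemotright> \<otimes> c \<tau>) \<noteq> \<zero>"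
    then obtain y where y: "\<And>\<sigma>. \<sigma> \<in> ?J \<Longrightarrow> int p dvd (\<Sum>\<tau>\<in>?I. y \<tau> * incidence \<sigma> \<tau>)"
      "(\<Oplus>\<tau>\<in>?I. \<guillemotleft>y \<tau>\<guillemotright> \<otimes> c \<tau>) \<noteq> \<zero>" by blast
    obtain a where a: "\<forall>\<tau>\<in>?I. int p dvd y \<tau> - (\<Sum>\<rho>\<in>?K. a \<rho> * incidence \<tau> \<rho>)"
      using cohomology y(1) by blast
    have "(\<Oplus>\<tau>\<in>?I. \<guillemotleft>y \<tau>\<guillemotright> \<otimes> c \<tau>) = (\<Oplus>\<tau>\<in>?I. \<Oplus>\<rho>\<in>?K. \<guillemotleft>a \<rho>\<guillemotright> \<otimes> (c \<tau> \<otimes> \<guillemotleft>incidence \<tau> \<rho>\<guillemotright>))"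
    proof (intro finsum_cong')
      fix \<tau> assume \<tau>: "\<tau> \<in> ?I"
      let ?s = "\<Sum>\<rho>\<in>?K. a \<rho> * incidence \<tau> \<rho>"
      have "\<guillemotleft>y \<tau> - ?s\<guillemotright> = \<zero>" using a \<tau> zero by blast
      then have "\<guillemotleft>y \<tau>\<guillemotright> = \<guillemotleft>?s\<guillemotright>" using eq_diff0[of "\<guillemotleft>y \<tau>\<guillemotright>" "\<guillemotleft>?s\<guillemotright>"] by simp
      also have "\<guillemotleft>?s\<guillemotright> \<otimes> c \<tau> = (\<Oplus>\<rho>\<in>?K. \<guillemotleft>a \<rho> * incidence \<tau> \<rho>\<guillemotright> \<otimes> c \<tau>)"
        unfolding of_integer_sum[OF finf] using cc[OF \<tau>] finf by (intro finsum_ldistr) auto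
      also have "\<dots> = (\<Oplus>\<rho>\<in>?K. \<guillemotleft>a \<rho>\<guillemotright> \<otimes> (c \<tau> \<otimes> \<guillemotleft>incidence \<tau> \<rho>\<guillemotright>))"
        using cc[OF \<tau>] by (intro finsum_cong') (auto simp: m_ac)
      finally show "\<guillemotleft>y \<tau>\<guillemotright> \<otimes> c \<tau> = (\<Oplus>\<rho>\<in>?K. \<guillemotleft>a \<rho>\<guillemotright> \<otimes> (c \<tau> \<otimes> \<guillemotleft>incidence \<tau> \<rho>\<guillemotright>))" .
    qed (use cc in \<open>auto intro!: finsum_closed\<close>)
    also have "\<dots> = (\<Oplus>\<rho>\<in>?K. \<Oplus>\<tau>\<in>?I. \<guillemotleft>a \<rho>\<guillemotright> \<otimes> (c \<tau> \<otimes> \<guillemotleft>incidence \<tau> \<rho>\<guillemotright>))"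
      using cc by (intro finsum_swap finf) auto
    also have "\<dots> = (\<Oplus>\<rho>\<in>?K. \<zero>)"
    proof (intro finsum_cong')
      fix \<rho> assume \<rho>: "\<rho> \<in> ?K"
      have "(\<Oplus>\<tau>\<in>?I. \<guillemotleft>a \<rho>\<guillemotright> \<otimes> (c \<tau> \<otimes> \<guillemotleft>incidence \<tau> \<rho>\<guillemotright>)) = \<guillemotleft>a \<rho>\<guillemotright> \<otimes> (\<Oplus>\<tau>\<in>?I. c \<tau> \<otimes> \<guillemotleft>incidence \<tau> \<rho>\<guillemotright>)"
        using cc finf by (intro finsum_rdistr[symmetric]) auto
      also have "(\<Oplus>\<tau>\<in>?I. c \<tau> \<otimes> \<guillemotleft>incidence \<tau> \<rho>\<guillemotright>) = bdry R D j c \<rho>"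
        by (rule bdry_eq_incidence[symmetric, OF finf cc \<rho>])
      finally show "(\<Oplus>\<tau>\<in>?I. \<guillemotleft>a \<rho>\<guillemotright> \<otimes> (c \<tau> \<otimes> \<guillemotleft>incidence \<tau> \<rho>\<guillemotright>)) = \<zero>" by (simp add: cycle)
    qed auto
    finally show ?thesis using y(2) by (simp add: finsum_zero)
  qed
qed

section \<open>Coboundaries evaluated on vertices, edges and triangles\<close>

lemma sum_incidence:
  assumes down: "\<And>F G. F \<in> D \<Longrightarrow> G \<subseteq> F \<Longrightarrow> G \<noteq> {} \<Longrightarrow> G \<in> D" and fin: "finite (faces D d)"
    and \<sigma>: "\<sigma> \<in> faces D (Suc d)"
  shows "(\<Sum>\<tau>\<in>faces D d. g \<tau> * incidence \<sigma> \<tau>)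
    = (\<Sum>v\<in>\<sigma>. (if even (card {u \<in> \<sigma>. u < v}) then 1 else -1) * g (\<sigma> - {v}))"
proof -
  have \<sigma>D: "\<sigma> \<in> D" "card \<sigma> = Suc d" using \<sigma> by (auto simp: faces_def)
  then have fs: "finite \<sigma>" by (metis card.infinite nat.distinct(1))
  have "(\<Sum>\<tau>\<in>faces D d. g \<tau> * incidence \<sigma> \<tau>) = (\<Sum>\<tau>\<in>(\<lambda>v. \<sigma> - {v}) ` \<sigma>. g \<tau> * incidence \<sigma> \<tau>)"
  proof (rule sum.mono_neutral_right[OF fin])
    show "(\<lambda>v. \<sigma> - {v}) ` \<sigma> \<subseteq> faces D d"
    proof clarify
      fix v assume v: "v \<in> \<sigma>"
      have "card (\<sigma> - {v}) = d" using \<sigma>D(2) v fs by simp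
      \<comment> \<open>When \<sigma> is a single vertex, its facet is the empty face of the
        augmented complex.\<close>
      moreover have "\<sigma> - {v} \<in> insert {} D" using down[OF \<sigma>D(1), of "\<sigma> - {v}"] by blast
      ultimately show "\<sigma> - {v} \<in> faces D d" by (simp add: faces_def)
    qed
    have "\<tau> \<in> (\<lambda>v. \<sigma> - {v}) ` \<sigma>" if \<tau>: "\<tau> \<in> faces D d" "\<tau> \<subseteq> \<sigma>" for \<tau>
    proof -
      have "card (\<sigma> - \<tau>) = 1"
        using \<tau> \<sigma>D(2) fs by (simp add: faces_def card_Diff_subset finite_subset)
      then obtain v where "\<sigma> - \<tau> = {v}" by (auto simp: card_1_singleton_iff)
      then have "v \<in> \<sigma>" "\<tau> = \<sigma> - {v}" using \<tau>(2) by auto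
      then show ?thesis by blast
    qed
    then show "\<forall>\<tau>\<in>faces D d - (\<lambda>v. \<sigma> - {v}) ` \<sigma>. g \<tau> * incidence \<sigma> \<tau> = 0"
      by (auto simp: incidence_def)
  qed
  also have "\<dots> = (\<Sum>v\<in>\<sigma>. g (\<sigma> - {v}) * incidence \<sigma> (\<sigma> - {v}))"
    by (subst sum.reindex) (auto simp: inj_on_def)
  also have "\<dots> = (\<Sum>v\<in>\<sigma>. (if even (card {u \<in> \<sigma>. u < v}) then 1 else -1) * g (\<sigma> - {v}))"
  proof (rule sum.cong[OF refl])
    fix v assume "v \<in> \<sigma>"
    then have "\<sigma> - (\<sigma> - {v}) = {v}" by blast
    then show "g (\<sigma> - {v}) * incidence \<sigma> (\<sigma> - {v})
        = (if even (card {u \<in> \<sigma>. u < v}) then 1 else -1) * g (\<sigma> - {v})"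
      by (auto simp: incidence_def)
  qed
  finally show ?thesis .
qed

lemma signed_sum_edge:
  fixes i k :: nat and g :: "nat set \<Rightarrow> int"
  assumes "i < k"
  shows "(\<Sum>v\<in>{i, k}. (if even (card {u \<in> {i, k}. u < v}) then 1 else -1) * g ({i, k} - {v})) = g {k} - g {i}"
proof -
  have "{u \<in> {i, k}. u < i} = {}" "{u \<in> {i, k}. u < k} = {i}" "{i, k} - {i} = {k}" "{i, k} - {k} = {i}"
    "sum F {i, k} = F i + F k" for F :: "nat \<Rightarrow> int"
    using assms by auto
  then show ?thesis by (simp only:) simp
qed

lemma signed_sum_triangle:
  fixes i j k :: nat and g :: "nat set \<Rightarrow> int"
  assumes "i < j" "j < k"
  shows "(\<Sum>v\<in>{i, j, k}. (if even (card {u \<in> {i, j, k}. u < v}) then 1 else -1) * g ({i, j, k} - {v}))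
    = g {j, k} - g {i, k} + g {i, j}"
proof -
  have "{u \<in> {i, j, k}. u < i} = {}" "{u \<in> {i, j, k}. u < j} = {i}" "{u \<in> {i, j, k}. u < k} = {i, j}"
    "{i, j, k} - {i} = {j, k}" "{i, j, k} - {j} = {i, k}" "{i, j, k} - {k} = {i, j}"
    "sum F {i, j, k} = F i + F j + F k" for F :: "nat \<Rightarrow> int"
    using assms by auto
  then show ?thesis using assms by (simp only:) simp
qed

section \<open>Vanishing of the two homology groups\<close>

context complete_local_depth3
begin

lemma finite_D: "finite D"
  by (rule finite_subset[of _ "Pow {1..n}"]) (auto simp: Delta_def)

lemma finite_faces: "finite (faces D d)"
  using finite_D by (simp add: faces_def)

lemma sum_incidence_D:
  assumes "F \<in> faces D (Suc d)"
  shows "(\<Sum>G\<in>faces D d. g G * incidence F G)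
    = (\<Sum>v\<in>F. (if even (card {u \<in> F. u < v}) then 1 else -1) * g (F - {v}))"
  using face_subset finite_faces assms by (rule sum_incidence)

lemma residue_field: "field (R Quot m)"
  using sep_closed by (simp add: separably_closed_def)

lemma residue_char: "\<guillemotleft>i\<guillemotright>\<^bsub>R Quot m\<^esub> = \<zero>\<^bsub>R Quot m\<^esub> \<longleftrightarrow> int p dvd i"
  by (rule of_integer_quot_eq_zero[OF prime_p char_p prime_m])

lemma homology_0: "reduced_homology_zero (R Quot m) D 0"
proof (rule field.reduced_homology_zeroI[OF residue_field prime_p residue_char finite_D])
  fix y assume y: "\<And>\<sigma>. \<sigma> \<in> faces D (Suc (Suc 0)) \<Longrightarrow>
      int p dvd (\<Sum>\<tau>\<in>faces D (Suc 0). y \<tau> * incidence \<sigma> \<tau>)"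
  have edge: "int p dvd y {k} - y {i}" if "{i, k} \<in> D" "i < k" for i k
  proof -
    have face: "{i, k} \<in> faces D (Suc (Suc 0))" using that by (simp add: faces_def)
    from y[OF face] show ?thesis
      unfolding sum_incidence_D[OF face] signed_sum_edge[OF that(2)] .
  qed
  have c: "int p dvd y {i} - y {k}" if "{i, k} \<in> D" for i k
    using edge[of i k] edge[of k i] that
    by (cases i k rule: linorder_cases) (simp_all add: insert_commute dvd_diff_commute)
  \<comment> \<open>The augmented complex has the empty face as its only face of cardinality zero,
    so a coboundary on vertices is a constant; the constant used is the value at a base vertex. If
    there are no vertices, the claim is vacuous.\<close>
  define i0 where "i0 = (SOME i. {i} \<in> D)"
  have "int p dvd y \<tau> - (\<Sum>\<rho>\<in>faces D 0. y {i0} * incidence \<tau> \<rho>)" if \<tau>: "\<tau> \<in> faces D (Suc 0)" for \<tau>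
  proof -
    obtain i where i: "\<tau> = {i}" "{i} \<in> D" using \<tau> by (auto simp: faces_def card_1_singleton_iff)
    then have i0: "{i0} \<in> D" unfolding i0_def by (metis someI)
    have "int p dvd y {i} - y {i0}" by (rule cocycle0_constant[of "\<lambda>i. y {i}", OF c i(2) i0])
    moreover have "(\<Sum>\<rho>\<in>faces D 0. y {i0} * incidence \<tau> \<rho>) = y {i0}"
    proof -
      have empty: "{u. u = i \<and> u < i} = {}" by auto
      show ?thesis unfolding sum_incidence_D[OF \<tau>] unfolding i(1) by (simp add: empty)
    qed
    ultimately show ?thesis using i(1) by simp
  qed
  then show "\<exists>a. \<forall>\<tau>\<in>faces D (Suc 0). int p dvd y \<tau> - (\<Sum>\<rho>\<in>faces D 0. a \<rho> * incidence \<tau> \<rho>)"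
    by (intro exI[of _ "\<lambda>_. y {i0}"]) blast
qed

lemma homology_1: "reduced_homology_zero (R Quot m) D 1"
  unfolding One_nat_def
proof (rule field.reduced_homology_zeroI[OF residue_field prime_p residue_char finite_D])
  fix y assume y: "\<And>\<sigma>. \<sigma> \<in> faces D (Suc (Suc (Suc 0))) \<Longrightarrow>
      int p dvd (\<Sum>\<tau>\<in>faces D (Suc (Suc 0)). y \<tau> * incidence \<sigma> \<tau>)"
  have tri: "int p dvd y {j, k} - y {i, k} + y {i, j}" if "{i, j, k} \<in> D" "i < j" "j < k" for i j k
  proof -
    have face: "{i, j, k} \<in> faces D (Suc (Suc (Suc 0)))" using that by (simp add: faces_def)
    from y[OF face] show ?thesis
      unfolding sum_incidence_D[OF face] signed_sum_triangle[OF that(2,3)] .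
  qed
  \<comment> \<open>The cochain is given on increasing edges only. Its alternating extension
    satisfies the cocycle identity for all ordered triples: triples with a repetition are trivial,
    and the six orderings reduce to the increasing one.\<close>
  define c where "c i j = (if i < j then y {i, j} else if j < i then - y {i, j} else 0)" for i j
  have anti: "c j i = - c i j" for i j by (simp add: c_def insert_commute)
  have tri': "int p dvd c i j + c j k - c i k" if "{i, j, k} \<in> D" "i < j" "j < k" for i j k
    using tri[OF that] that by (simp add: c_def algebra_simps)
  have "int p dvd c i j + c j k - c i k" if D: "{i, j, k} \<in> D" for i j k
  proof -
    have perm: "{i, k, j} \<in> D" "{j, i, k} \<in> D" "{j, k, i} \<in> D" "{k, i, j} \<in> D" "{k, j, i} \<in> D"
      using D by (simp_all add: insert_commute)
    consider "i = j" | "j = k" | "i = k" | "i < j" "j < k" | "i < k" "k < j" | "j < i" "i < k"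
      | "j < k" "k < i" | "k < i" "i < j" | "k < j" "j < i" by linarith
    then show ?thesis
    proof cases
      case 1
      then show ?thesis by (simp add: c_def)
    next
      case 2
      then show ?thesis by (simp add: c_def)
    next
      case 3
      then show ?thesis using anti[of k j] by (simp add: c_def)
    next
      case 4
      then show ?thesis by (rule tri'[OF D])
    next
      case 5
      have eq: "c i j + c j k - c i k = - (c i k + c k j - c i j)"
        using anti[of i j] anti[of i k] anti[of j k] by simp
      show ?thesis unfolding eq dvd_minus_iff by (rule tri'[OF perm(1) 5])
    next
      case 6
      have eq: "c i j + c j k - c i k = - (c j i + c i k - c j k)"
        using anti[of i j] anti[of i k] anti[of j k] by simp
      show ?thesis unfolding eq dvd_minus_iff by (rule tri'[OF perm(2) 6])
    next
      case 7
      have eq: "c i j + c j k - c i k = c j k + c k i - c j i"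
        using anti[of i j] anti[of i k] anti[of j k] by simp
      show ?thesis unfolding eq by (rule tri'[OF perm(3) 7])
    next
      case 8
      have eq: "c i j + c j k - c i k = c k i + c i j - c k j"
        using anti[of i j] anti[of i k] anti[of j k] by simp
      show ?thesis unfolding eq by (rule tri'[OF perm(4) 8])
    next
      case 9
      have eq: "c i j + c j k - c i k = - (c k j + c j i - c k i)"
        using anti[of i j] anti[of i k] anti[of j k] by simp
      show ?thesis unfolding eq dvd_minus_iff by (rule tri'[OF perm(5) 9])
    qed
  qed
  from cocycle1_coboundary[of c, OF this]
  obtain a where a: "\<And>i j. {i, j} \<in> D \<Longrightarrow> int p dvd c i j - (a j - a i)" by blast
  define A where "A \<rho> = a (the_elem \<rho>)" for \<rho>
  have "int p dvd y \<tau> - (\<Sum>\<rho>\<in>faces D (Suc 0). A \<rho> * incidence \<tau> \<rho>)"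
    if \<tau>: "\<tau> \<in> faces D (Suc (Suc 0))" for \<tau>
  proof -
    have "card \<tau> = 2" "\<tau> \<in> D" using \<tau> by (auto simp: faces_def)
    then obtain x z where "\<tau> = {x, z}" "x \<noteq> z" by (auto simp: card_2_iff)
    then obtain i k where ik: "\<tau> = {i, k}" "i < k" by (metis insert_commute linorder_neqE_nat)
    have "(\<Sum>\<rho>\<in>faces D (Suc 0). A \<rho> * incidence \<tau> \<rho>) = a k - a i"
      unfolding sum_incidence_D[OF \<tau>] unfolding ik(1) signed_sum_edge[OF ik(2)] by (simp add: A_def)
    then show ?thesis using a[of i k] ik \<open>\<tau> \<in> D\<close> by (simp add: c_def)
  qed
  then show "\<exists>a. \<forall>\<tau>\<in>faces D (Suc (Suc 0)). int p dvd y \<tau> - (\<Sum>\<rho>\<in>faces D (Suc 0). a \<rho> * incidence \<tau> \<rho>)"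
    by blast
qed

end

theorem theorem1p2:
  fixes R :: "('a, 'b) ring_scheme" and m :: "'a set" and p n :: nat and P :: "nat \<Rightarrow> 'a set"
  assumes "noetherian_ring R"
    and "local_ring R m"
    and "adic_complete R m"
    and "Factorial_Ring.prime p" and "has_char R p"
    and "separably_closed (R Quot m)"
    and "depth_ge R m 3"
    and "bij_betw P {1..n} {Q. minimal_prime R Q}"
  shows "reduced_homology_zero (R Quot m) (Delta R m n P) 0
       \<and> reduced_homology_zero (R Quot m) (Delta R m n P) 1"
proof -
  have "cring R" using assms(2) by (simp add: local_ring_def)
  then interpret complete_local_depth3 R m p n P
    using assms by (intro complete_local_depth3.intro complete_local_depth3_axioms.intro)
  show ?thesis using homology_0 homology_1 by blast
qed

end
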